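(* Let $P$ be a quantum program and $M,N$ binary measurements. Then: (1) (Loop as a Fixpoint) $M\ast P\equiv\mathbf{skip}\vartriangleleft M\vartriangleright(P;(M\ast P))$. (2) (Loop Unfolding) If $M\propto N$, then $\mathbf{skip}\vartriangleleft N\vartriangleright(M\ast P)\equiv\mathbf{skip}\vartriangleleft N\vartriangleright(P;(M\ast P))$. (3) (Loop Elimination) If $M^\bot\propto N$, then $\mathbf{skip}\vartriangleleft N\vartriangleright(M\ast P)\equiv[N]$. (4) (Postcondition) If $N\gg M$, then $M\ast P\equiv(M\ast P);[N]$.
   Context: A set $QV$ of quantum variables is given; each quantum variable $q$ has a Hilbert space $\mathcal H_q$; a register $\bar q$ is a sequence $q_1,\dots,q_n$ of distinct variables with space $\mathcal H_{\bar q}=\bigotimes_i\mathcal H_{q_i}$. $\mathcal H_{QV}$ is the state space of the composite system of all variables in $QV$; operators on $\mathcal H_{\bar q}$ are identified with their extensions by the identity. $\mathcal D(\mathcal H_{QV})$ is the set of partial density operators (positive operators of trace $\le1$) on $\mathcal H_{QV}$. Circuits: $C::=\mathbf{skip}\mid U[\bar q]\mid C_1;C_2\mid \mathbf{qif}\,[\bar q](\square_{i=1}^d|\psi_i\rangle\to C_i)\,\mathbf{fiq}$ ($U$ a unitary constant from a given set, $\{|\psi_i\rangle\}$ an orthonormal basis of $\mathcal H_{\bar q}$, $\bar q$ disjoint from the variables of all $C_i$), with unitary semantics $I$, $U_{\bar q}$, $[\![C_2]\!][\![C_1]\!]$, $\sum_i|\psi_i\rangle_{\bar q}\langle\psi_i|\otimes[\![C_i]\!]$.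 A measurement on $\bar q$ is a family $M=\{M_m\}$ of linear operators with $\sum_mM_m^\dagger M_m=I$; binary if the outcomes are $0,1$. Programs: $P::=\mathbf{skip}\mid\mathbf{abort}\mid\bar q:=|\psi\rangle\mid C\mid P_1;P_2\mid\mathbf{if}\,M[\bar q](\square m\to P_m)\,\mathbf{fi}\mid\mathbf{while}\,M[\bar q]=1\,\mathbf{do}\,P\,\mathbf{od}$ ($M$ binary in loops). Semantics on $\mathcal D(\mathcal H_{QV})$: $[\![\mathbf{skip}]\!](\rho)=\rho$; $[\![\mathbf{abort}]\!](\rho)=0$; $[\![\bar q:=|\psi\rangle]\!](\rho)=\sum_n|\psi\rangle_{\bar q}\langle n|\rho|n\rangle_{\bar q}\langle\psi|$ ($\{|n\rangle\}$ an orthonormal basis of $\mathcal H_{\bar q}$); $[\![C]\!](\rho)=[\![C]\!]\rho[\![C]\!]^\dagger$; $[\![P_1;P_2]\!]=[\![P_2]\!]\circ[\![P_1]\!]$; $[\![\mathbf{if}\,M[\bar q](\square m\to P_m)\,\mathbf{fi}]\!](\rho)=\sum_m[\![P_m]\!](M_m\rho M_m^\dagger)$; $[\![\mathbf{while}\,M[\bar q]=1\,\mathbf{do}\,P\,\mathbf{od}]\!]=\sum_{n\ge0}\mathcal E_0\circ([\![P]\!]\circ\mathcal E_1)^n$, $\mathcal E_i(\rho)=M_i\rho M_i^\dagger$. $P\equiv Q$ iff $[\![P]\!]=[\![Q]\!]$. Notation, for binary $M=\{M_0,M_1\}$ (measured register omitted): $P_0\vartriangleleft M\vartriangleright P_1$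 is the if-statement executing $P_0$ on outcome $0$ and $P_1$ on outcome $1$; $[M]$ abbreviates $\mathbf{skip}\vartriangleleft M\vartriangleright\mathbf{skip}$; $M\ast P$ is the loop $\mathbf{while}\,M[\bar q]=1\,\mathbf{do}\,P\,\mathbf{od}$. $M^\bot$ has $(M^\bot)_0=M_1$, $(M^\bot)_1=M_0$. $M\propto N$ iff $M_1N_1=cN_1$ for some $c\in\mathbb C$ with $|c|=1$. $M\gg N$ iff $M\propto N^\bot$. *)

theory Defs
  imports "HOL-Analysis.Analysis"
begin

text \<open>
  Hilbert spaces are taken in coordinates: every Hilbert space has an orthonormal basis, so it is
  \<open>\<ell>\<^sup>2(X)\<close> for some index set \<open>X\<close> of arbitrary cardinality, and a bounded operator \<open>A\<close> on it is given
  by its matrix \<open>A x y = \<langle>x|A|y\<rangle>\<close>.  Vectors vanish outside \<open>X\<close> and matrices outside \<open>X \<times> X\<close>, so that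
  equality of vectors and operators is equality of functions.
\<close>

type_synonym 'a vec = "'a \<Rightarrow> complex"
type_synonym 'a mat = "'a \<Rightarrow> 'a \<Rightarrow> complex"

definition ell2 :: "'a set \<Rightarrow> 'a vec set" where
  "ell2 X = {v. (\<forall>x. x \<notin> X \<longrightarrow> v x = 0) \<and> (\<lambda>x. (cmod (v x))\<^sup>2) summable_on X}"

definition inner_prod :: "'a set \<Rightarrow> 'a vec \<Rightarrow> 'a vec \<Rightarrow> complex" where
  "inner_prod X v w = (\<Sum>\<^sub>\<infinity>x\<in>X. cnj (v x) * w x)"

definition ell2_norm :: "'a set \<Rightarrow> 'a vec \<Rightarrow> real" where
  "ell2_norm X v = sqrt (\<Sum>\<^sub>\<infinity>x\<in>X. (cmod (v x))\<^sup>2)"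

definition mat_apply :: "'a set \<Rightarrow> 'a mat \<Rightarrow> 'a vec \<Rightarrow> 'a vec" where
  "mat_apply X A v = (\<lambda>x. \<Sum>\<^sub>\<infinity>y\<in>X. A x y * v y)"

definition mat_mult :: "'a set \<Rightarrow> 'a mat \<Rightarrow> 'a mat \<Rightarrow> 'a mat" where
  "mat_mult X A B = (\<lambda>x y. \<Sum>\<^sub>\<infinity>z\<in>X. A x z * B z y)"

definition adjoint_mat :: "'a mat \<Rightarrow> 'a mat" where
  "adjoint_mat A = (\<lambda>x y. cnj (A y x))"

definition id_mat :: "'a set \<Rightarrow> 'a mat" where
  "id_mat X = (\<lambda>x y. if x \<in> X \<and> x = y then 1 else 0)"

definition ket :: "'a \<Rightarrow> 'a vec" where
  "ket n = (\<lambda>x. if x = n then 1 else 0)"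

text \<open>\<open>ketbra v w\<close> is \<open>|v\<rangle>\<langle>w|\<close>, and \<open>conj_by X A \<rho>\<close> is \<open>A \<rho> A\<^sup>\<dagger>\<close>.\<close>

definition ketbra :: "'a vec \<Rightarrow> 'a vec \<Rightarrow> 'a mat" where
  "ketbra v w = (\<lambda>x y. v x * cnj (w y))"

definition conj_by :: "'a set \<Rightarrow> 'a mat \<Rightarrow> 'a mat \<Rightarrow> 'a mat" where
  "conj_by X A \<rho> = mat_mult X (mat_mult X A \<rho>) (adjoint_mat A)"

definition bounded_op :: "'a set \<Rightarrow> 'a mat \<Rightarrow> bool" where
  "bounded_op X A \<longleftrightarrow>
     (\<forall>x y. x \<notin> X \<or> y \<notin> X \<longrightarrow> A x y = 0) \<and>
     (\<exists>K. \<forall>v\<in>ell2 X. mat_apply X A v \<in> ell2 X \<and> ell2_norm X (mat_apply X A v) \<le> K * ell2_norm X v)"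

definition unitary_op :: "'a set \<Rightarrow> 'a mat \<Rightarrow> bool" where
  "unitary_op X U \<longleftrightarrow> bounded_op X U \<and>
     mat_mult X (adjoint_mat U) U = id_mat X \<and> mat_mult X U (adjoint_mat U) = id_mat X"

definition positive_op :: "'a set \<Rightarrow> 'a mat \<Rightarrow> bool" where
  "positive_op X A \<longleftrightarrow> bounded_op X A \<and> (\<forall>v\<in>ell2 X. inner_prod X v (mat_apply X A v) \<in> \<real>\<^sub>\<ge>\<^sub>0)"

text \<open>Partial density operators.  Summability of the diagonal is the trace class condition for
  positive operators; it is needed because \<open>infsum\<close> is \<open>0\<close> on non-summable families.\<close>

definition partial_density :: "'a set \<Rightarrow> 'a mat set" where
  "partial_density X =
     {\<rho>. positive_op X \<rho> \<and> (\<lambda>x. \<rho> x x) summable_on X \<and> Re (\<Sum>\<^sub>\<infinity>x\<in>X. \<rho> x x) \<le> 1}"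

definition finite_onb :: "'a set \<Rightarrow> nat \<Rightarrow> (nat \<Rightarrow> 'a vec) \<Rightarrow> bool" where
  "finite_onb X d \<psi> \<longleftrightarrow>
     (\<forall>i<d. \<psi> i \<in> ell2 X) \<and>
     (\<forall>i<d. \<forall>j<d. inner_prod X (\<psi> i) (\<psi> j) = (if i = j then 1 else 0)) \<and>
     (\<forall>v\<in>ell2 X. \<exists>a. v = (\<lambda>x. \<Sum>i<d. a i * \<psi> i x))"

text \<open>
  The quantum variables are the elements of the type \<open>'q\<close>, and \<open>\<H>\<^sub>q = \<ell>\<^sup>2(B q)\<close>.  A register is a list
  \<open>qs\<close> of distinct variables, with \<open>\<H>\<^bsub>qs\<^esub> = \<ell>\<^sup>2(reg_basis B qs)\<close>.  The composite system of all
  variables has the product basis \<open>configs B e\<close>.  If \<open>'q\<close> is finite, this is the set of all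
  \<open>c\<close> with \<open>c q \<in> B q\<close>, whatever \<open>e\<close> is; if \<open>'q\<close> is infinite, \<open>\<ell>\<^sup>2(configs B e)\<close> is the infinite
  tensor product along the reference vectors \<open>|e q\<rangle>\<close>.
\<close>

definition reg_basis :: "('q \<Rightarrow> 'b set) \<Rightarrow> 'q list \<Rightarrow> 'b list set" where
  "reg_basis B qs = {xs. list_all2 (\<lambda>x q. x \<in> B q) xs qs}"

definition configs :: "('q \<Rightarrow> 'b set) \<Rightarrow> ('q \<Rightarrow> 'b) \<Rightarrow> ('q \<Rightarrow> 'b) set" where
  "configs B e = {c. (\<forall>q. c q \<in> B q) \<and> finite {q. c q \<noteq> e q}}"

text \<open>The extension \<open>A \<otimes> I\<close> of an operator on \<open>\<H>\<^bsub>qs\<^esub>\<close> to the space of all variables.\<close>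

definition extend ::
  "('q \<Rightarrow> 'b set) \<Rightarrow> ('q \<Rightarrow> 'b) \<Rightarrow> 'q list \<Rightarrow> 'b list mat \<Rightarrow> ('q \<Rightarrow> 'b) mat" where
  "extend B e qs A = (\<lambda>c c'.
     if c \<in> configs B e \<and> c' \<in> configs B e \<and> (\<forall>q. q \<notin> set qs \<longrightarrow> c q = c' q)
     then A (map c qs) (map c' qs) else 0)"

text \<open>In \<open>CQif qs d \<psi> C\<close>, only the values of \<open>\<psi>\<close> and \<open>C\<close> at \<open>0, \<dots>, d - 1\<close> matter.\<close>

datatype ('q, 'b) circ =
    CSkip
  | CGate "'b list mat" "'q list"
  | CSeq "('q, 'b) circ" "('q, 'b) circ"
  | CQif "'q list" nat "nat \<Rightarrow> 'b list vec" "nat \<Rightarrow> ('q, 'b) circ"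

primrec circ_vars :: "('q, 'b) circ \<Rightarrow> 'q set" where
  "circ_vars CSkip = {}"
| "circ_vars (CGate U qs) = set qs"
| "circ_vars (CSeq C D) = circ_vars C \<union> circ_vars D"
| "circ_vars (CQif qs d \<psi> C) = set qs \<union> (\<Union>i<d. circ_vars (C i))"

text \<open>\<open>G\<close> is the given set of unitary constants.\<close>

primrec wf_circ :: "('q \<Rightarrow> 'b set) \<Rightarrow> 'b list mat set \<Rightarrow> ('q, 'b) circ \<Rightarrow> bool" where
  "wf_circ B G CSkip \<longleftrightarrow> True"
| "wf_circ B G (CGate U qs) \<longleftrightarrow> distinct qs \<and> U \<in> G \<and> unitary_op (reg_basis B qs) U"
| "wf_circ B G (CSeq C D) \<longleftrightarrow> wf_circ B G C \<and> wf_circ B G D"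
| "wf_circ B G (CQif qs d \<psi> C) \<longleftrightarrow>
     distinct qs \<and> finite_onb (reg_basis B qs) d \<psi> \<and>
     (\<forall>i<d. wf_circ B G (C i) \<and> set qs \<inter> circ_vars (C i) = {})"

text \<open>In the last clause both factors act on the whole space; since \<open>qs\<close> is disjoint from the
  variables of \<open>C i\<close>, their product is \<open>|\<psi>\<^sub>i\<rangle>\<langle>\<psi>\<^sub>i| \<otimes> \<lbrakk>C\<^sub>i\<rbrakk>\<close>.\<close>

primrec circ_sem :: "('q \<Rightarrow> 'b set) \<Rightarrow> ('q \<Rightarrow> 'b) \<Rightarrow> ('q, 'b) circ \<Rightarrow> ('q \<Rightarrow> 'b) mat" where
  "circ_sem B e CSkip = id_mat (configs B e)"
| "circ_sem B e (CGate U qs) = extend B e qs U"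
| "circ_sem B e (CSeq C D) = mat_mult (configs B e) (circ_sem B e D) (circ_sem B e C)"
| "circ_sem B e (CQif qs d \<psi> C) = (\<lambda>c c'.
     \<Sum>i<d. mat_mult (configs B e) (extend B e qs (ketbra (\<psi> i) (\<psi> i))) (circ_sem B e (C i)) c c')"

datatype ('q, 'b) meas =
  Meas (mreg: "'q list") (outcomes: "nat set") (mop: "nat \<Rightarrow> 'b list mat")

definition measurement :: "('q \<Rightarrow> 'b set) \<Rightarrow> ('q, 'b) meas \<Rightarrow> bool" where
  "measurement B M \<longleftrightarrow>
     distinct (mreg M) \<and>
     (\<forall>m\<in>outcomes M. bounded_op (reg_basis B (mreg M)) (mop M m)) \<and>
     (\<forall>x y. ((\<lambda>m. mat_mult (reg_basis B (mreg M)) (adjoint_mat (mop M m)) (mop M m) x y)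
        has_sum id_mat (reg_basis B (mreg M)) x y) (outcomes M))"

definition binary_measurement :: "('q \<Rightarrow> 'b set) \<Rightarrow> ('q, 'b) meas \<Rightarrow> bool" where
  "binary_measurement B M \<longleftrightarrow> measurement B M \<and> outcomes M = {0, 1}"

definition meas_op ::
  "('q \<Rightarrow> 'b set) \<Rightarrow> ('q \<Rightarrow> 'b) \<Rightarrow> ('q, 'b) meas \<Rightarrow> nat \<Rightarrow> ('q \<Rightarrow> 'b) mat" where
  "meas_op B e M m = extend B e (mreg M) (mop M m)"

datatype ('q, 'b) prog =
    Skip
  | Abort
  | Init "'q list" "'b list vec"
  | Circ "('q, 'b) circ"
  | Seq "('q, 'b) prog" "('q, 'b) prog"  (infixr \<open>;;\<close> 60)
  | If "('q, 'b) meas" "nat \<Rightarrow> ('q, 'b) prog"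
  | While "('q, 'b) meas" "('q, 'b) prog"

primrec wf_prog :: "('q \<Rightarrow> 'b set) \<Rightarrow> 'b list mat set \<Rightarrow> ('q, 'b) prog \<Rightarrow> bool" where
  "wf_prog B G Skip \<longleftrightarrow> True"
| "wf_prog B G Abort \<longleftrightarrow> True"
| "wf_prog B G (Init qs \<psi>) \<longleftrightarrow>
     distinct qs \<and> \<psi> \<in> ell2 (reg_basis B qs) \<and> ell2_norm (reg_basis B qs) \<psi> = 1"
| "wf_prog B G (Circ C) \<longleftrightarrow> wf_circ B G C"
| "wf_prog B G (P ;; Q) \<longleftrightarrow> wf_prog B G P \<and> wf_prog B G Q"
| "wf_prog B G (If M P) \<longleftrightarrow> measurement B M \<and> (\<forall>m\<in>outcomes M. wf_prog B G (P m))"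
| "wf_prog B G (While M P) \<longleftrightarrow> binary_measurement B M \<and> wf_prog B G P"

text \<open>The infinite sums of operators are taken entrywise.  For well-formed programs and partial
  density operators they are sums of positive operators with bounded total trace, so they converge
  in trace norm and the entrywise sum is the limit.\<close>

primrec prog_sem ::
  "('q \<Rightarrow> 'b set) \<Rightarrow> ('q \<Rightarrow> 'b) \<Rightarrow> ('q, 'b) prog \<Rightarrow> ('q \<Rightarrow> 'b) mat \<Rightarrow> ('q \<Rightarrow> 'b) mat" where
  "prog_sem B e Skip = (\<lambda>\<rho>. \<rho>)"
| "prog_sem B e Abort = (\<lambda>\<rho> c c'. 0)"
| "prog_sem B e (Init qs \<psi>) = (\<lambda>\<rho> c c'.
     \<Sum>\<^sub>\<infinity>n\<in>reg_basis B qs. conj_by (configs B e) (extend B e qs (ketbra \<psi> (ket n))) \<rho> c c')"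
| "prog_sem B e (Circ C) = (\<lambda>\<rho>. conj_by (configs B e) (circ_sem B e C) \<rho>)"
| "prog_sem B e (P ;; Q) = prog_sem B e Q \<circ> prog_sem B e P"
| "prog_sem B e (If M P) = (\<lambda>\<rho> c c'.
     \<Sum>\<^sub>\<infinity>m\<in>outcomes M. prog_sem B e (P m) (conj_by (configs B e) (meas_op B e M m) \<rho>) c c')"
| "prog_sem B e (While M P) = (\<lambda>\<rho> c c'.
     \<Sum>\<^sub>\<infinity>n\<in>UNIV. (conj_by (configs B e) (meas_op B e M 0) \<circ>
       (prog_sem B e P \<circ> conj_by (configs B e) (meas_op B e M 1)) ^^ n) \<rho> c c')"

definition prog_equiv ::
  "('q \<Rightarrow> 'b set) \<Rightarrow> ('q \<Rightarrow> 'b) \<Rightarrow> ('q, 'b) prog \<Rightarrow> ('q, 'b) prog \<Rightarrow> bool" where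
  "prog_equiv B e P Q \<longleftrightarrow>
     (\<forall>\<rho>\<in>partial_density (configs B e). prog_sem B e P \<rho> = prog_sem B e Q \<rho>)"

definition cond :: "('q, 'b) prog \<Rightarrow> ('q, 'b) meas \<Rightarrow> ('q, 'b) prog \<Rightarrow> ('q, 'b) prog"
    (\<open>(_ \<triangleleft> _ \<triangleright> _)\<close> [56, 56, 56] 55) where
  "P\<^sub>0 \<triangleleft> M \<triangleright> P\<^sub>1 = If M (\<lambda>m. if m = 0 then P\<^sub>0 else P\<^sub>1)"

definition just_measure :: "('q, 'b) meas \<Rightarrow> ('q, 'b) prog" where
  "just_measure M = Skip \<triangleleft> M \<triangleright> Skip"

definition perp :: "('q, 'b) meas \<Rightarrow> ('q, 'b) meas" where
  "perp M = Meas (mreg M) (outcomes M) (\<lambda>m. if m = 0 then mop M 1 else mop M 0)"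

definition meas_propto ::
  "('q \<Rightarrow> 'b set) \<Rightarrow> ('q \<Rightarrow> 'b) \<Rightarrow> ('q, 'b) meas \<Rightarrow> ('q, 'b) meas \<Rightarrow> bool" where
  "meas_propto B e M N \<longleftrightarrow>
     (\<exists>\<alpha>. cmod \<alpha> = 1 \<and>
        mat_mult (configs B e) (meas_op B e M 1) (meas_op B e N 1) = (\<lambda>c c'. \<alpha> * meas_op B e N 1 c c'))"

definition meas_gg ::
  "('q \<Rightarrow> 'b set) \<Rightarrow> ('q \<Rightarrow> 'b) \<Rightarrow> ('q, 'b) meas \<Rightarrow> ('q, 'b) meas \<Rightarrow> bool" where
  "meas_gg B e M N \<longleftrightarrow> meas_propto B e M (perp N)"

end

theory Submission
  imports Defs
begin

text \<open>
  Finite-dimensional arguments are transported to infinite matrices by truncation. An operator is a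
  contraction if it is one on finitely supported vectors, and a family of Kraus operators is a
  single contraction once stacked into a rectangular matrix. Such a matrix \<open>A\<close> maps a positive
  trace class \<open>\<rho>\<close> to a positive trace class \<open>A \<rho> A\<^sup>\<dagger>\<close> of no larger trace. Hence every program is trace
  nonincreasing, the terms of a loop have summable traces, and the loop may be unfolded once.
  The relation \<open>M \<propto> N\<close> says that \<open>M\<^sub>1\<close> fixes, up to a phase, every state \<open>\<sigma>\<close> produced by outcome \<open>1\<close>
  of \<open>N\<close>; the trace bound \<open>tr M\<^sub>0 \<sigma> M\<^sub>0\<^sup>\<dagger> + tr M\<^sub>1 \<sigma> M\<^sub>1\<^sup>\<dagger> \<le> tr \<sigma>\<close> then forces \<open>M\<^sub>0 \<sigma> M\<^sub>0\<^sup>\<dagger> = 0\<close>.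
\<close>

section \<open>Contractions\<close>

text \<open>Every identity to be proved is an identity of entries, and an entry of a product is an
  \<open>infsum\<close>, which is 0 whenever the family is not summable. Products of infinite
  matrices are then in general neither associative nor compatible with infinite sums, so each
  rearrangement has to be paid for with a summability proof. Two sources supply it: the bound 1 on
  the operator norm, which controls rows, columns and tails, and the inequality
  \<open>|\<rho> x y|\<^sup>2 \<le> \<rho> x x * \<rho> y y\<close>, which lets the trace dominate
  all entries of a state. For measurements a norm bound on each operator separately would be too
  weak: only \<open>\<Sum>\<^sub>m M\<^sub>m\<^sup>\<dagger> M\<^sub>m = I\<close>, used for the
  whole family at once, makes the traces of all branches add up to at most the trace of the input.
  Among circuits the delicate case is the quantum conditional, whose norm is controlled because
  every branch commutes with the projections on the control register.\<close>

definition sq_summable :: "'a set \<Rightarrow> ('a \<Rightarrow> complex) \<Rightarrow> bool" where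
  "sq_summable X v \<longleftrightarrow> (\<lambda>x. (cmod (v x))\<^sup>2) summable_on X"

lemma sq_summableI:
  assumes "\<And>F. finite F \<Longrightarrow> F \<subseteq> X \<Longrightarrow> (\<Sum>x\<in>F. (cmod (v x))\<^sup>2) \<le> C"
  shows "sq_summable X v"
  unfolding sq_summable_def
  by (rule nonneg_bdd_above_summable_on) (auto intro!: bdd_aboveI2[where M=C] assms)

lemma sq_summable_cnj [simp]: "sq_summable X (\<lambda>x. cnj (v x)) = sq_summable X v"
  by (simp add: sq_summable_def)

lemma sq_summable_abs_mult:
  assumes "sq_summable X v" "sq_summable X w"
  shows "(\<lambda>x. norm (v x * w x)) summable_on X"
  by (rule abs_summable_product)
    (use assms in \<open>simp_all add: sq_summable_def norm_mult power2_eq_square\<close>)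

lemma sq_summable_mult:
  assumes "sq_summable X v" "sq_summable X w"
  shows "(\<lambda>x. v x * w x) summable_on X"
  by (rule abs_summable_summable[OF sq_summable_abs_mult[OF assms]])

lemma sq_summable_add:
  assumes "sq_summable X v" "sq_summable X w"
  shows "sq_summable X (\<lambda>x. v x + w x)"
  unfolding sq_summable_def
proof (rule summable_on_comparison_test)
  show "(\<lambda>x. 2 * (cmod (v x))\<^sup>2 + 2 * (cmod (w x))\<^sup>2) summable_on X"
    using assms unfolding sq_summable_def by (intro summable_on_add summable_on_cmult_right)
  fix x
  have "(cmod (v x + w x))\<^sup>2 \<le> (cmod (v x) + cmod (w x))\<^sup>2"
    by (intro power_mono norm_triangle_ineq) auto
  also have "\<dots> \<le> 2 * (cmod (v x))\<^sup>2 + 2 * (cmod (w x))\<^sup>2"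
    using zero_le_power2[of "cmod (v x) - cmod (w x)"] by (simp add: power2_eq_square algebra_simps)
  finally show "(cmod (v x + w x))\<^sup>2 \<le> 2 * (cmod (v x))\<^sup>2 + 2 * (cmod (w x))\<^sup>2" .
qed auto

lemma has_sum_sum:
  fixes f :: "'i \<Rightarrow> 'a \<Rightarrow> complex"
  assumes "\<And>i. i \<in> F \<Longrightarrow> (f i has_sum S i) X"
  shows "((\<lambda>x. \<Sum>i\<in>F. f i x) has_sum (\<Sum>i\<in>F. S i)) X"
  using assms
  by (induction F rule: infinite_finite_induct) (auto intro: has_sum_add)

lemma sq_summable_cmult:
  assumes "sq_summable X v"
  shows "sq_summable X (\<lambda>x. c * v x)"
  using assms unfolding sq_summable_def norm_mult power_mult_distrib
  by (rule summable_on_cmult_right)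

lemma sq_summable_sum:
  assumes "\<And>i. i \<in> F \<Longrightarrow> sq_summable X (v i)"
  shows "sq_summable X (\<lambda>x. \<Sum>i\<in>F. v i x)"
  using assms
proof (induction F rule: infinite_finite_induct)
  case (insert i F)
  then show ?case by (simp add: sq_summable_add)
qed (auto simp: sq_summable_def)

text \<open>Cauchy-Schwarz on finite subsets bounds the partial sums of the moduli uniformly, hence
  also the infinite sum. No conjugate appears, since conjugating \<open>v\<close> changes no
  modulus.\<close>

lemma cmod_infsum_mult_le:
  assumes "sq_summable X v" "sq_summable X w"
  shows "cmod (\<Sum>\<^sub>\<infinity>x\<in>X. v x * w x)
    \<le> sqrt (\<Sum>\<^sub>\<infinity>x\<in>X. (cmod (v x))\<^sup>2) * sqrt (\<Sum>\<^sub>\<infinity>x\<in>X. (cmod (w x))\<^sup>2)"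
proof -
  have sm: "(\<lambda>x. norm (v x * w x)) summable_on X"
    using sq_summable_abs_mult[OF assms] .
  have "cmod (\<Sum>\<^sub>\<infinity>x\<in>X. v x * w x) \<le> (\<Sum>\<^sub>\<infinity>x\<in>X. norm (v x * w x))"
    by (rule norm_infsum_bound[OF sm])
  also have "\<dots> \<le> sqrt (\<Sum>\<^sub>\<infinity>x\<in>X. (cmod (v x))\<^sup>2) * sqrt (\<Sum>\<^sub>\<infinity>x\<in>X. (cmod (w x))\<^sup>2)"
  proof (rule infsum_le_finite_sums[OF sm])
    fix F assume F: "finite F" "F \<subseteq> X"
    have "(\<Sum>x\<in>F. norm (v x * w x)) \<le> L2_set (\<lambda>x. cmod (v x)) F * L2_set (\<lambda>x. cmod (w x)) F"
      using L2_set_mult_ineq[of "\<lambda>x. cmod (v x)" "\<lambda>x. cmod (w x)" F] by (simp add: norm_mult)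
    also have "\<dots> \<le> sqrt (\<Sum>\<^sub>\<infinity>x\<in>X. (cmod (v x))\<^sup>2) * sqrt (\<Sum>\<^sub>\<infinity>x\<in>X. (cmod (w x))\<^sup>2)"
      unfolding L2_set_def
      by (intro mult_mono real_sqrt_le_mono finite_sum_le_infsum)
        (use assms F in \<open>auto simp: sq_summable_def intro!: infsum_nonneg sum_nonneg\<close>)
    finally show "(\<Sum>x\<in>F. norm (v x * w x)) \<le> \<dots>" .
  qed
  finally show ?thesis .
qed

text \<open>Operator norm at most 1, tested on finitely supported vectors with finitely many output
  coordinates counted, so no convergence is presupposed. Rows and columns have separate index sets,
  which admits stacked families.\<close>

definition contraction :: "'r set \<Rightarrow> 's set \<Rightarrow> ('r \<Rightarrow> 's \<Rightarrow> complex) \<Rightarrow> bool" where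
  "contraction R S A \<longleftrightarrow> (\<forall>F G v. finite F \<longrightarrow> F \<subseteq> R \<longrightarrow> finite G \<longrightarrow> G \<subseteq> S \<longrightarrow>
     (\<Sum>r\<in>F. (cmod (\<Sum>s\<in>G. A r s * v s))\<^sup>2) \<le> (\<Sum>s\<in>G. (cmod (v s))\<^sup>2))"

lemma contractionI:
  assumes "\<And>F G v. finite F \<Longrightarrow> F \<subseteq> R \<Longrightarrow> finite G \<Longrightarrow> G \<subseteq> S \<Longrightarrow>
     (\<Sum>r\<in>F. (cmod (\<Sum>s\<in>G. A r s * v s))\<^sup>2) \<le> (\<Sum>s\<in>G. (cmod (v s))\<^sup>2)"
  shows "contraction R S A"
  using assms unfolding contraction_def by blast

lemma contractionD:
  assumes "contraction R S A" "finite F" "F \<subseteq> R" "finite G" "G \<subseteq> S"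
  shows "(\<Sum>r\<in>F. (cmod (\<Sum>s\<in>G. A r s * v s))\<^sup>2) \<le> (\<Sum>s\<in>G. (cmod (v s))\<^sup>2)"
  using assms unfolding contraction_def by blast

lemma contraction_cong:
  assumes "\<And>r s. r \<in> R \<Longrightarrow> s \<in> S \<Longrightarrow> A r s = A' r s"
  shows "contraction R S A = contraction R S A'"
proof -
  have *: "contraction R S A'" if "contraction R S A" "\<And>r s. r \<in> R \<Longrightarrow> s \<in> S \<Longrightarrow> A r s = A' r s"
    for A A' :: "'a \<Rightarrow> 'b \<Rightarrow> complex"
  proof (rule contractionI)
    fix F G v assume *: "finite F" "F \<subseteq> R" "finite G" "G \<subseteq> S"
    have "(\<Sum>r\<in>F. (cmod (\<Sum>s\<in>G. A' r s * v s))\<^sup>2) = (\<Sum>r\<in>F. (cmod (\<Sum>s\<in>G. A r s * v s))\<^sup>2)"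
      using * that(2) by (intro sum.cong refl arg_cong[where f="\<lambda>z. (cmod z)\<^sup>2"]) force
    then show "(\<Sum>r\<in>F. (cmod (\<Sum>s\<in>G. A' r s * v s))\<^sup>2) \<le> (\<Sum>s\<in>G. (cmod (v s))\<^sup>2)"
      using contractionD[OF that(1) *] by simp
  qed
  show ?thesis using *[of A A'] *[of A' A] assms by auto
qed

lemma contraction_reindex:
  assumes A: "contraction R' S' A'"
    and f: "inj_on f R" "f ` R \<subseteq> R'" and g: "inj_on g S" "g ` S \<subseteq> S'"
    and eq: "\<And>r s. r \<in> R \<Longrightarrow> s \<in> S \<Longrightarrow> A r s = A' (f r) (g s)"
  shows "contraction R S A"
proof (rule contractionI)
  fix F G v assume *: "finite F" "F \<subseteq> R" "finite G" "G \<subseteq> S"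
  have injF: "inj_on f F" and injG: "inj_on g G"
    using f(1) g(1) * by (auto intro: inj_on_subset)
  \<comment> \<open>\<open>inv_into G g\<close> carries \<open>v\<close> to a vector on the image of
    \<open>G\<close>, where the hypothesis on \<open>A'\<close> applies.\<close>
  have "(\<Sum>r\<in>F. (cmod (\<Sum>s\<in>G. A r s * v s))\<^sup>2)
      = (\<Sum>r\<in>F. (cmod (\<Sum>s\<in>G. A' (f r) (g s) * v (inv_into G g (g s))))\<^sup>2)"
    using * injG by (intro sum.cong refl arg_cong[where f="\<lambda>z. (cmod z)\<^sup>2"])
      (auto simp: eq subsetD inv_into_f_f)
  also have "\<dots> = (\<Sum>r\<in>f ` F. (cmod (\<Sum>s\<in>g ` G. A' r s * v (inv_into G g s)))\<^sup>2)"
    by (simp add: sum.reindex[OF injF] sum.reindex[OF injG])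
  also have "\<dots> \<le> (\<Sum>s\<in>g ` G. (cmod (v (inv_into G g s)))\<^sup>2)"
    by (rule contractionD[OF A]) (use * f g in blast)+
  also have "\<dots> = (\<Sum>s\<in>G. (cmod (v s))\<^sup>2)"
    using injG by (simp add: sum.reindex[OF injG] inv_into_f_f)
  finally show "(\<Sum>r\<in>F. (cmod (\<Sum>s\<in>G. A r s * v s))\<^sup>2) \<le> (\<Sum>s\<in>G. (cmod (v s))\<^sup>2)" .
qed

text \<open>With \<open>w = A\<^sup>\<dagger> v\<close> and \<open>u = A w\<close>, both cut off to
  finite index sets, \<open>\<parallel>w\<parallel>\<^sup>2 = \<langle>v, u\<rangle> \<le>
  \<parallel>v\<parallel> \<parallel>u\<parallel> \<le> \<parallel>v\<parallel>
  \<parallel>w\<parallel>\<close>; it remains to cancel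
  \<open>\<parallel>w\<parallel>\<close>.\<close>

lemma contraction_adjoint:
  assumes A: "contraction R S A"
  shows "contraction S R (\<lambda>s r. cnj (A r s))"
proof (rule contractionI)
  fix F G v assume *: "finite F" "F \<subseteq> S" "finite G" "G \<subseteq> R"
  define w where "w s = (\<Sum>r\<in>G. cnj (A r s) * v r)" for s
  define u where "u r = (\<Sum>s\<in>F. A r s * w s)" for r
  define a where "a = L2_set (\<lambda>s. cmod (w s)) F"
  define b where "b = L2_set (\<lambda>r. cmod (v r)) G"
  have nn: "a \<ge> 0" "b \<ge> 0" by (auto simp: a_def b_def)
  have a2: "a\<^sup>2 = (\<Sum>s\<in>F. (cmod (w s))\<^sup>2)" and b2: "b\<^sup>2 = (\<Sum>r\<in>G. (cmod (v r))\<^sup>2)"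
    by (auto simp: a_def b_def L2_set_def intro!: real_sqrt_pow2 sum_nonneg)
  have "complex_of_real (a\<^sup>2) = (\<Sum>s\<in>F. cnj (w s) * w s)"
    by (simp only: a2 of_real_sum complex_norm_square mult.commute)
  also have "\<dots> = (\<Sum>s\<in>F. \<Sum>r\<in>G. A r s * cnj (v r) * w s)"
    by (simp add: w_def sum_distrib_right)
  also have "\<dots> = (\<Sum>r\<in>G. \<Sum>s\<in>F. A r s * cnj (v r) * w s)"
    by (rule sum.swap)
  also have "\<dots> = (\<Sum>r\<in>G. cnj (v r) * u r)"
    by (simp add: u_def sum_distrib_left mult_ac)
  finally have "a\<^sup>2 = cmod (\<Sum>r\<in>G. cnj (v r) * u r)"
    by (metis norm_of_real abs_power2)
  also have "\<dots> \<le> (\<Sum>r\<in>G. \<bar>cmod (v r)\<bar> * \<bar>cmod (u r)\<bar>)"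
    by (rule order_trans[OF norm_sum]) (simp add: norm_mult)
  also have "\<dots> \<le> b * L2_set (\<lambda>r. cmod (u r)) G"
    unfolding b_def by (rule L2_set_mult_ineq)
  also have "\<dots> \<le> b * a"
    unfolding a_def L2_set_def u_def
    by (intro mult_left_mono real_sqrt_le_mono contractionD[OF A] nn) (use * in auto)
  finally have "a\<^sup>2 \<le> b * a" .
  then have "a \<le> b"
    using nn by (cases "a = 0") (auto simp: power2_eq_square)
  then have "a\<^sup>2 \<le> b\<^sup>2" using nn by (intro power_mono)
  then show "(\<Sum>s\<in>F. (cmod (\<Sum>r\<in>G. cnj (A r s) * v r))\<^sup>2) \<le> (\<Sum>r\<in>G. (cmod (v r))\<^sup>2)"
    by (simp add: a2 b2 w_def)
qed

lemma contraction_column: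
  assumes "contraction R S A" "s \<in> S"
  shows "sq_summable R (\<lambda>r. A r s)"
proof (rule sq_summableI)
  fix F assume "finite F" "F \<subseteq> R"
  then show "(\<Sum>r\<in>F. (cmod (A r s))\<^sup>2) \<le> 1"
    using contractionD[OF assms(1), of F "{s}" "\<lambda>_. 1"] assms(2) by simp
qed

lemma contraction_row:
  assumes "contraction R S A" "r \<in> R"
  shows "sq_summable S (\<lambda>s. A r s)"
  using contraction_column[OF contraction_adjoint[OF assms(1)] assms(2)] by simp

text \<open>For fixed finite \<open>F\<close> both sides are limits of the finite inequality as
  \<open>G\<close> exhausts \<open>S\<close>; square summable rows make each coordinate of the image
  converge.\<close>

lemma contraction_apply_le:
  assumes A: "contraction R S A" and v: "sq_summable S v" and F: "finite F" "F \<subseteq> R"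
  shows "(\<Sum>r\<in>F. (cmod (\<Sum>\<^sub>\<infinity>s\<in>S. A r s * v s))\<^sup>2) \<le> (\<Sum>\<^sub>\<infinity>s\<in>S. (cmod (v s))\<^sup>2)"
proof (rule tendsto_le[OF finite_subsets_at_top_neq_bot])
  show "((\<lambda>G. \<Sum>s\<in>G. (cmod (v s))\<^sup>2) \<longlongrightarrow> (\<Sum>\<^sub>\<infinity>s\<in>S. (cmod (v s))\<^sup>2)) (finite_subsets_at_top S)"
    using v unfolding sq_summable_def by (rule infsum_tendsto)
  show "((\<lambda>G. \<Sum>r\<in>F. (cmod (\<Sum>s\<in>G. A r s * v s))\<^sup>2) \<longlongrightarrow>
      (\<Sum>r\<in>F. (cmod (\<Sum>\<^sub>\<infinity>s\<in>S. A r s * v s))\<^sup>2)) (finite_subsets_at_top S)"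
    by (intro tendsto_sum tendsto_power tendsto_norm infsum_tendsto sq_summable_mult
        contraction_row[OF A] v) (use F in auto)
  show "\<forall>\<^sub>F G in finite_subsets_at_top S.
      (\<Sum>r\<in>F. (cmod (\<Sum>s\<in>G. A r s * v s))\<^sup>2) \<le> (\<Sum>s\<in>G. (cmod (v s))\<^sup>2)"
    by (rule eventually_finite_subsets_at_top_weakI) (use contractionD[OF A F] in auto)
qed

lemma contraction_apply_sq_summable:
  assumes "contraction R S A" "sq_summable S v"
  shows "sq_summable R (\<lambda>r. \<Sum>\<^sub>\<infinity>s\<in>S. A r s * v s)"
  by (rule sq_summableI) (rule contraction_apply_le[OF assms])

lemma contraction_apply_infsum_le:
  assumes "contraction R S A" "sq_summable S v"
  shows "(\<Sum>\<^sub>\<infinity>r\<in>R. (cmod (\<Sum>\<^sub>\<infinity>s\<in>S. A r s * v s))\<^sup>2) \<le> (\<Sum>\<^sub>\<infinity>s\<in>S. (cmod (v s))\<^sup>2)"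
  by (rule infsum_le_finite_sums)
    (use contraction_apply_sq_summable[OF assms] contraction_apply_le[OF assms]
      in \<open>auto simp: sq_summable_def\<close>)

lemma contraction_apply_finite_le:
  assumes "contraction R S A" "finite G" "G \<subseteq> S"
  shows "(\<Sum>\<^sub>\<infinity>r\<in>R. (cmod (\<Sum>s\<in>G. A r s * v s))\<^sup>2) \<le> (\<Sum>s\<in>G. (cmod (v s))\<^sup>2)"
proof (rule infsum_le_finite_sums)
  have "sq_summable R (\<lambda>r. \<Sum>s\<in>G. A r s * v s)"
    by (rule sq_summableI) (rule contractionD[OF assms(1) _ _ assms(2,3)])
  then show "(\<lambda>r. (cmod (\<Sum>s\<in>G. A r s * v s))\<^sup>2) summable_on R"
    by (simp add: sq_summable_def)
qed (use contractionD[OF assms(1) _ _ assms(2,3)] in auto)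

text \<open>The double sum need not converge absolutely; the tails of \<open>v\<close> are small in norm,
  and so are their images under the contraction \<open>A\<close>.\<close>

lemma contraction_assoc_has_sum:
  assumes A: "contraction R S A" and v: "sq_summable S v" and a: "sq_summable R a"
  shows "((\<lambda>s. (\<Sum>\<^sub>\<infinity>r\<in>R. a r * A r s) * v s) has_sum (\<Sum>\<^sub>\<infinity>r\<in>R. a r * (\<Sum>\<^sub>\<infinity>s\<in>S. A r s * v s))) S"
proof -
  define na where "na = (\<Sum>\<^sub>\<infinity>r\<in>R. (cmod (a r))\<^sup>2)"
  define nv where "nv = (\<Sum>\<^sub>\<infinity>s\<in>S. (cmod (v s))\<^sup>2)"
  define L where "L = (\<Sum>\<^sub>\<infinity>r\<in>R. a r * (\<Sum>\<^sub>\<infinity>s\<in>S. A r s * v s))"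
  have bound: "cmod (L - (\<Sum>s\<in>G. (\<Sum>\<^sub>\<infinity>r\<in>R. a r * A r s) * v s))
      \<le> sqrt na * sqrt (nv - (\<Sum>s\<in>G. (cmod (v s))\<^sup>2))" if G: "finite G" "G \<subseteq> S" for G
  proof -
    define v' where "v' s = (if s \<in> G then 0 else v s)" for s
    have v': "sq_summable S v'"
      unfolding sq_summable_def
      by (rule summable_on_comparison_test[OF v[unfolded sq_summable_def]]) (auto simp: v'_def)
    have nv': "(\<Sum>\<^sub>\<infinity>s\<in>S. (cmod (v' s))\<^sup>2) = nv - (\<Sum>s\<in>G. (cmod (v s))\<^sup>2)"
    proof -
      have "nv = (\<Sum>\<^sub>\<infinity>s\<in>S. (cmod (v' s))\<^sup>2 + (if s \<in> G then (cmod (v s))\<^sup>2 else 0))"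
        unfolding nv_def by (intro infsum_cong) (auto simp: v'_def)
      also have "\<dots> = (\<Sum>\<^sub>\<infinity>s\<in>S. (cmod (v' s))\<^sup>2) + (\<Sum>\<^sub>\<infinity>s\<in>S. (if s \<in> G then (cmod (v s))\<^sup>2 else 0))"
        using v' G unfolding sq_summable_def
        by (intro infsum_add) (auto intro!: finite_nonzero_values_imp_summable_on elim: finite_subset[rotated])
      also have "(\<Sum>\<^sub>\<infinity>s\<in>S. (if s \<in> G then (cmod (v s))\<^sup>2 else 0)) = (\<Sum>s\<in>G. (cmod (v s))\<^sup>2)"
        using G by (intro infsumI has_sum_finite_neutralI[of G]) auto
      finally show ?thesis by simp
    qed
    have row: "(\<lambda>s. A r s * v s) summable_on S" "(\<lambda>s. A r s * v' s) summable_on S" if "r \<in> R" for r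
      by (intro sq_summable_mult contraction_row[OF A that] v v')+
    have split: "(\<Sum>\<^sub>\<infinity>s\<in>S. A r s * v s) = (\<Sum>\<^sub>\<infinity>s\<in>S. A r s * v' s) + (\<Sum>s\<in>G. A r s * v s)"
      if "r \<in> R" for r
    proof -
      have "(\<Sum>\<^sub>\<infinity>s\<in>S. A r s * v s) = (\<Sum>\<^sub>\<infinity>s\<in>S. A r s * v' s + (if s \<in> G then A r s * v s else 0))"
        by (intro infsum_cong) (auto simp: v'_def)
      also have "\<dots> = (\<Sum>\<^sub>\<infinity>s\<in>S. A r s * v' s) + (\<Sum>\<^sub>\<infinity>s\<in>S. if s \<in> G then A r s * v s else 0)"
        by (intro infsum_add row that finite_nonzero_values_imp_summable_on)
          (use G in \<open>auto elim: finite_subset[rotated]\<close>)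
      also have "(\<Sum>\<^sub>\<infinity>s\<in>S. if s \<in> G then A r s * v s else 0) = (\<Sum>s\<in>G. A r s * v s)"
        using G by (intro infsumI has_sum_finite_neutralI[of G]) auto
      finally show ?thesis .
    qed
    have col: "(\<lambda>r. a r * A r s) summable_on R" if "s \<in> S" for s
      by (intro sq_summable_mult a contraction_column[OF A that])
    \<comment> \<open>The part of \<open>v\<close> on \<open>G\<close> yields a finite sum, which
      may be exchanged with the sum over \<open>R\<close>; what remains of \<open>L\<close> is
      \<open>a\<close> paired with the image of the tail.\<close>
    have "L = (\<Sum>\<^sub>\<infinity>r\<in>R. a r * (\<Sum>\<^sub>\<infinity>s\<in>S. A r s * v' s) + (\<Sum>s\<in>G. (a r * A r s) * v s))"
      unfolding L_def
      by (intro infsum_cong) (simp add: split distrib_left sum_distrib_left mult.assoc)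
    also have "\<dots> = (\<Sum>\<^sub>\<infinity>r\<in>R. a r * (\<Sum>\<^sub>\<infinity>s\<in>S. A r s * v' s)) + (\<Sum>\<^sub>\<infinity>r\<in>R. \<Sum>s\<in>G. (a r * A r s) * v s)"
      by (intro infsum_add sq_summable_mult a contraction_apply_sq_summable[OF A v']
          sum_infsum has_sum_imp_summable[OF has_sum_sum] )
        (use G col in \<open>auto intro!: has_sum_infsum summable_on_cmult_left\<close>)
    also have "(\<Sum>\<^sub>\<infinity>r\<in>R. \<Sum>s\<in>G. (a r * A r s) * v s) = (\<Sum>s\<in>G. (\<Sum>\<^sub>\<infinity>r\<in>R. a r * A r s) * v s)"
      using G col
      by (subst infsum_cmult_left'[symmetric])
        (intro infsumI has_sum_sum has_sum_infsum summable_on_cmult_left; auto)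
    finally have "cmod (L - (\<Sum>s\<in>G. (\<Sum>\<^sub>\<infinity>r\<in>R. a r * A r s) * v s))
        = cmod (\<Sum>\<^sub>\<infinity>r\<in>R. a r * (\<Sum>\<^sub>\<infinity>s\<in>S. A r s * v' s))" by simp
    also have "\<dots> \<le> sqrt na * sqrt (\<Sum>\<^sub>\<infinity>r\<in>R. (cmod (\<Sum>\<^sub>\<infinity>s\<in>S. A r s * v' s))\<^sup>2)"
      unfolding na_def by (intro cmod_infsum_mult_le a contraction_apply_sq_summable[OF A v'])
    also have "\<dots> \<le> sqrt na * sqrt (nv - (\<Sum>s\<in>G. (cmod (v s))\<^sup>2))"
      unfolding nv'[symmetric]
      by (intro mult_left_mono real_sqrt_le_mono contraction_apply_infsum_le[OF A v'])
        (auto simp: na_def intro!: infsum_nonneg)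
    finally show ?thesis .
  qed
  have "((\<lambda>G. sqrt na * sqrt (nv - (\<Sum>s\<in>G. (cmod (v s))\<^sup>2))) \<longlongrightarrow> sqrt na * sqrt (nv - nv))
      (finite_subsets_at_top S)"
    unfolding nv_def using v unfolding sq_summable_def
    by (intro tendsto_intros infsum_tendsto)
  then have lim: "((\<lambda>G. sqrt na * sqrt (nv - (\<Sum>s\<in>G. (cmod (v s))\<^sup>2))) \<longlongrightarrow> 0) (finite_subsets_at_top S)"
    by simp
  have "((\<lambda>G. \<Sum>s\<in>G. (\<Sum>\<^sub>\<infinity>r\<in>R. a r * A r s) * v s) \<longlongrightarrow> L) (finite_subsets_at_top S)"
    by (rule LIM_zero_cancel, rule Lim_null_comparison[OF _ lim], 
        rule eventually_finite_subsets_at_top_weakI, subst norm_minus_commute) (rule bound)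
  then show ?thesis by (simp add: has_sum_def L_def)
qed

lemmas contraction_assoc = infsumI[OF contraction_assoc_has_sum]

text \<open>\<open>B v\<close> is merely square summable even if \<open>v\<close> has finite
  support, so \<open>A\<close> has to act through its bound for infinite sums; the finite sum over
  the support of \<open>v\<close> commutes with the sum over \<open>S\<close>.\<close>

lemma contraction_mult:
  assumes A: "contraction R S A" and B: "contraction S T B"
  shows "contraction R T (\<lambda>r t. \<Sum>\<^sub>\<infinity>s\<in>S. A r s * B s t)"
proof (rule contractionI)
  fix F G v assume *: "finite F" "F \<subseteq> R" "finite G" "G \<subseteq> T"
  have sq: "sq_summable S (\<lambda>s. \<Sum>t\<in>G. B s t * v t)"
    by (rule sq_summableI) (use contractionD[OF B] * in blast)
  have "(\<Sum>t\<in>G. (\<Sum>\<^sub>\<infinity>s\<in>S. A r s * B s t) * v t) = (\<Sum>\<^sub>\<infinity>s\<in>S. A r s * (\<Sum>t\<in>G. B s t * v t))"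
    if r: "r \<in> F" for r
  proof -
    have "(\<lambda>s. A r s * B s t) summable_on S" if "t \<in> G" for t
      by (intro sq_summable_mult contraction_row[OF A] contraction_column[OF B]) (use * r that in auto)
    then have "((\<lambda>s. \<Sum>t\<in>G. A r s * B s t * v t) has_sum (\<Sum>t\<in>G. (\<Sum>\<^sub>\<infinity>s\<in>S. A r s * B s t) * v t)) S"
      by (intro has_sum_sum has_sum_cmult_left has_sum_infsum)
    then show ?thesis
      by (subst infsumI[symmetric], assumption) (simp add: sum_distrib_left mult_ac)
  qed
  then have "(\<Sum>r\<in>F. (cmod (\<Sum>t\<in>G. (\<Sum>\<^sub>\<infinity>s\<in>S. A r s * B s t) * v t))\<^sup>2)
      = (\<Sum>r\<in>F. (cmod (\<Sum>\<^sub>\<infinity>s\<in>S. A r s * (\<Sum>t\<in>G. B s t * v t)))\<^sup>2)" by simp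
  also have "\<dots> \<le> (\<Sum>\<^sub>\<infinity>s\<in>S. (cmod (\<Sum>t\<in>G. B s t * v t))\<^sup>2)"
    by (rule contraction_apply_le[OF A sq *(1,2)])
  also have "\<dots> \<le> (\<Sum>t\<in>G. (cmod (v t))\<^sup>2)"
    by (rule contraction_apply_finite_le[OF B *(3,4)])
  finally show "(\<Sum>r\<in>F. (cmod (\<Sum>t\<in>G. (\<Sum>\<^sub>\<infinity>s\<in>S. A r s * B s t) * v t))\<^sup>2) \<le> (\<Sum>t\<in>G. (cmod (v t))\<^sup>2)" .
qed

text \<open>\<open>f\<close> and \<open>g\<close> label rows and columns by blocks, and the matrix
  is block diagonal. The squared norms of a vector and of its image are sums over the labels, so the
  bound can be checked block by block.\<close>

lemma contraction_block:
  assumes zero: "\<And>r s. r \<in> R \<Longrightarrow> s \<in> S \<Longrightarrow> f r \<noteq> g s \<Longrightarrow> A r s = 0"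
    and block: "\<And>k. contraction {r\<in>R. f r = k} {s\<in>S. g s = k} A"
  shows "contraction R S A"
proof (rule contractionI)
  fix F G v assume *: "finite F" "F \<subseteq> R" "finite G" "G \<subseteq> S"
  define K where "K = f ` F \<union> g ` G"
  have K: "finite K" "f ` F \<subseteq> K" "g ` G \<subseteq> K" using * by (auto simp: K_def)
  have "(\<Sum>r\<in>F. (cmod (\<Sum>s\<in>G. A r s * v s))\<^sup>2)
      = (\<Sum>k\<in>K. \<Sum>r\<in>{r\<in>F. f r = k}. (cmod (\<Sum>s\<in>G. A r s * v s))\<^sup>2)"
    by (rule sum.group[OF *(1) K(1,2), symmetric])
  also have "\<dots> = (\<Sum>k\<in>K. \<Sum>r\<in>{r\<in>F. f r = k}. (cmod (\<Sum>s\<in>{s\<in>G. g s = k}. A r s * v s))\<^sup>2)"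
  proof (intro sum.cong refl)
    fix k r assume r: "r \<in> {r\<in>F. f r = k}"
    have "(\<Sum>s\<in>G. A r s * v s) = (\<Sum>s\<in>{s\<in>G. g s = k}. A r s * v s)"
    proof (rule sum.mono_neutral_right)
      show "\<forall>s\<in>G - {s\<in>G. g s = k}. A r s * v s = 0"
      proof
        fix s assume "s \<in> G - {s\<in>G. g s = k}"
        moreover from this have "r \<in> R" "s \<in> S" "f r \<noteq> g s" using r * by auto
        ultimately have "A r s = 0" using zero by blast
        then show "A r s * v s = 0" by simp
      qed
    qed (use * in auto)
    then show "(cmod (\<Sum>s\<in>G. A r s * v s))\<^sup>2 = (cmod (\<Sum>s\<in>{s\<in>G. g s = k}. A r s * v s))\<^sup>2"
      by simp
  qed
  also have "\<dots> \<le> (\<Sum>k\<in>K. \<Sum>s\<in>{s\<in>G. g s = k}. (cmod (v s))\<^sup>2)"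
    by (intro sum_mono contractionD[OF block]) (use * in auto)
  also have "\<dots> = (\<Sum>s\<in>G. (cmod (v s))\<^sup>2)"
    by (rule sum.group[OF *(3) K(1,3)])
  finally show "(\<Sum>r\<in>F. (cmod (\<Sum>s\<in>G. A r s * v s))\<^sup>2) \<le> (\<Sum>s\<in>G. (cmod (v s))\<^sup>2)" .
qed

lemma sum_double_cmod_square:
  fixes z :: "'s \<Rightarrow> complex"
  shows "(\<Sum>s\<in>G. \<Sum>s'\<in>G. cnj (z s) * z s') = complex_of_real ((cmod (\<Sum>s\<in>G. z s))\<^sup>2)"
proof -
  have "complex_of_real ((cmod (\<Sum>s\<in>G. z s))\<^sup>2) = cnj (\<Sum>s\<in>G. z s) * (\<Sum>s\<in>G. z s)"
    by (simp only: complex_norm_square mult.commute)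
  then show ?thesis by (simp add: sum_product)
qed

text \<open>Stacked on top of each other, the \<open>A m\<close> have orthonormal columns and thus
  form an isometry. The inner \<open>infsum\<close> is an entry of
  \<open>A\<^sub>m\<^sup>\<dagger> A\<^sub>m\<close>, so the hypothesis is the completeness relation
  of a measurement.\<close>

lemma contraction_of_gram:
  assumes col: "\<And>m s. m \<in> I \<Longrightarrow> s \<in> S \<Longrightarrow> sq_summable R (\<lambda>r. A m r s)"
    and gram: "\<And>s s'. s \<in> S \<Longrightarrow> s' \<in> S \<Longrightarrow>
      ((\<lambda>m. \<Sum>\<^sub>\<infinity>r\<in>R. cnj (A m r s) * A m r s') has_sum (if s = s' then 1 else 0)) I"
  shows "contraction (I \<times> R) S (\<lambda>(m, r). A m r)"
proof (rule contractionI)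
  fix F :: "('a \<times> 'c) set" and G v assume *: "finite F" "F \<subseteq> I \<times> R" "finite G" "G \<subseteq> S"
  \<comment> \<open>The squared norm of the component \<open>A\<^sub>m v\<close>. Expanded as a
    double sum over \<open>G\<close> and summed over \<open>m\<close>, it collapses to the squared
    norm of \<open>v\<close>.\<close>
  define h where "h m = (\<Sum>\<^sub>\<infinity>r\<in>R. (cmod (\<Sum>s\<in>G. A m r s * v s))\<^sup>2)" for m
  have sq: "sq_summable R (\<lambda>r. \<Sum>s\<in>G. A m r s * v s)" if "m \<in> I" for m
    using col that * 
    by (intro sq_summable_sum) (auto simp: mult.commute[of _ "v _"] intro!: sq_summable_cmult)
  have hm: "complex_of_real (h m) =
      (\<Sum>s\<in>G. \<Sum>s'\<in>G. cnj (v s) * v s' * (\<Sum>\<^sub>\<infinity>r\<in>R. cnj (A m r s) * A m r s'))" if m: "m \<in> I" for m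
  proof -
    have "((\<lambda>r. \<Sum>s\<in>G. \<Sum>s'\<in>G. cnj (v s) * v s' * (cnj (A m r s) * A m r s')) has_sum
      (\<Sum>s\<in>G. \<Sum>s'\<in>G. cnj (v s) * v s' * (\<Sum>\<^sub>\<infinity>r\<in>R. cnj (A m r s) * A m r s'))) R"
      by (intro has_sum_sum has_sum_cmult_right has_sum_infsum sq_summable_mult)
        (use col m * in auto)
    moreover have "(\<Sum>s\<in>G. \<Sum>s'\<in>G. cnj (v s) * v s' * (cnj (A m r s) * A m r s'))
        = complex_of_real ((cmod (\<Sum>s\<in>G. A m r s * v s))\<^sup>2)" for r
      unfolding sum_double_cmod_square[symmetric] by (intro sum.cong refl) simp
    ultimately have "((\<lambda>r. complex_of_real ((cmod (\<Sum>s\<in>G. A m r s * v s))\<^sup>2)) has_sum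
      (\<Sum>s\<in>G. \<Sum>s'\<in>G. cnj (v s) * v s' * (\<Sum>\<^sub>\<infinity>r\<in>R. cnj (A m r s) * A m r s'))) R"
      by simp
    moreover have "((\<lambda>r. complex_of_real ((cmod (\<Sum>s\<in>G. A m r s * v s))\<^sup>2)) has_sum h m) R"
      unfolding h_def by (intro has_sum_of_real has_sum_infsum) (use sq[OF m] in \<open>simp add: sq_summable_def\<close>)
    ultimately show ?thesis by (meson has_sum_unique)
  qed
  have "((\<lambda>m. complex_of_real (h m)) has_sum (\<Sum>s\<in>G. \<Sum>s'\<in>G. cnj (v s) * v s' * (if s = s' then 1 else 0))) I"
    by (subst has_sum_cong[OF hm], assumption) (intro has_sum_sum has_sum_cmult_right gram; use * in auto)
  also have "(\<Sum>s\<in>G. \<Sum>s'\<in>G. cnj (v s) * v s' * (if s = s' then 1 else 0))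
      = complex_of_real (\<Sum>s\<in>G. (cmod (v s))\<^sup>2)"
    using *(3) by (simp add: if_distrib sum.delta cong: if_cong) 
      (simp add: complex_norm_square[symmetric] mult.commute[of "cnj _"])
  finally have hs: "(h has_sum (\<Sum>s\<in>G. (cmod (v s))\<^sup>2)) I"
    by (simp only: has_sum_of_real_iff)
  \<comment> \<open>Enlarging \<open>F\<close> to the product of its two projections turns the sum
    over pairs into an iterated sum.\<close>
  have "(\<Sum>r\<in>F. (cmod (\<Sum>s\<in>G. (case r of (m, r) \<Rightarrow> A m r) s * v s))\<^sup>2)
      \<le> (\<Sum>r\<in>fst ` F \<times> snd ` F. (cmod (\<Sum>s\<in>G. (case r of (m, r) \<Rightarrow> A m r) s * v s))\<^sup>2)"
    using * by (intro sum_mono2) (auto intro: rev_image_eqI)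
  also have "\<dots> = (\<Sum>m\<in>fst ` F. \<Sum>r\<in>snd ` F. (cmod (\<Sum>s\<in>G. A m r s * v s))\<^sup>2)"
    using * by (simp add: sum.cartesian_product)
       (intro sum.cong refl, auto)
  also have "\<dots> \<le> (\<Sum>m\<in>fst ` F. h m)"
    unfolding h_def using sq * by (intro sum_mono finite_sum_le_infsum) (force simp: sq_summable_def)+
  also have "\<dots> \<le> (\<Sum>s\<in>G. (cmod (v s))\<^sup>2)"
    by (rule finite_sum_le_has_sum[OF hs]) (use * in \<open>auto simp: h_def intro!: infsum_nonneg\<close>)
  finally show "(\<Sum>r\<in>F. (cmod (\<Sum>s\<in>G. (case r of (m, r) \<Rightarrow> A m r) s * v s))\<^sup>2) \<le> (\<Sum>s\<in>G. (cmod (v s))\<^sup>2)" .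
qed

section \<open>Positive semidefinite matrices\<close>

text \<open>Positivity of all finite principal submatrices. Membership in
  \<open>\<real>\<^sub>\<ge>\<^sub>0\<close> includes being real, and self-adjointness follows from
  that.\<close>

definition psd :: "'a set \<Rightarrow> 'a mat \<Rightarrow> bool" where
  "psd X \<rho> \<longleftrightarrow> (\<forall>F v. finite F \<longrightarrow> F \<subseteq> X \<longrightarrow>
     (\<Sum>x\<in>F. \<Sum>y\<in>F. cnj (v x) * \<rho> x y * v y) \<in> \<real>\<^sub>\<ge>\<^sub>0)"

lemma psdI:
  assumes "\<And>F v. finite F \<Longrightarrow> F \<subseteq> X \<Longrightarrow> (\<Sum>x\<in>F. \<Sum>y\<in>F. cnj (v x) * \<rho> x y * v y) \<in> \<real>\<^sub>\<ge>\<^sub>0"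
  shows "psd X \<rho>"
  using assms unfolding psd_def by blast

lemma psdD:
  assumes "psd X \<rho>" "finite F" "F \<subseteq> X"
  shows "(\<Sum>x\<in>F. \<Sum>y\<in>F. cnj (v x) * \<rho> x y * v y) \<in> \<real>\<^sub>\<ge>\<^sub>0"
  using assms unfolding psd_def by blast

lemma psd_subset: "psd X \<rho> \<Longrightarrow> Y \<subseteq> X \<Longrightarrow> psd Y \<rho>"
  unfolding psd_def by (meson order_trans)

lemma psd_diag:
  assumes "psd X \<rho>" "x \<in> X"
  shows "Re (\<rho> x x) \<ge> 0" "Im (\<rho> x x) = 0"
  using psdD[OF assms(1), of "{x}" "\<lambda>_. 1"] assms(2) by (auto simp: complex_nonneg_Reals_iff)

lemma psd_two_points:
  assumes "psd X \<rho>" "x \<in> X" "y \<in> X" "x \<noteq> y"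
  shows "cnj a * \<rho> x x * a + cnj a * \<rho> x y * b + (cnj b * \<rho> y x * a + cnj b * \<rho> y y * b) \<in> \<real>\<^sub>\<ge>\<^sub>0"
  using psdD[OF assms(1), of "{x, y}" "\<lambda>z. if z = x then a else b"] assms(2-4) by auto

text \<open>The form is real at \<open>(1, 1)\<close> and at \<open>(1, \<i>)\<close>; the former
  relates the imaginary parts of the two entries, the latter their real parts.\<close>

lemma psd_hermitian:
  assumes "psd X \<rho>" "x \<in> X" "y \<in> X"
  shows "\<rho> y x = cnj (\<rho> x y)"
proof (cases "x = y")
  case True
  then show ?thesis using psd_diag[OF assms(1,2)] by (simp add: complex_eq_iff)
next
  case False
  have "Im (\<rho> x y) + Im (\<rho> y x) = 0"
    using psd_two_points[OF assms False, of 1 1] psd_diag(2)[OF assms(1)] assms(2,3)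
    by (simp add: complex_nonneg_Reals_iff)
  moreover have "Re (\<rho> x y) = Re (\<rho> y x)"
    using psd_two_points[OF assms False, of 1 \<i>] psd_diag(2)[OF assms(1)] assms(2,3)
    by (simp add: complex_nonneg_Reals_iff)
  ultimately show ?thesis by (simp add: complex_eq_iff)
qed

lemma psd_cauchy_schwarz:
  assumes "psd X \<rho>" "x \<in> X" "y \<in> X"
  shows "(cmod (\<rho> x y))\<^sup>2 \<le> Re (\<rho> x x) * Re (\<rho> y y)"
proof (cases "x = y")
  case True
  then show ?thesis using psd_diag[OF assms(1,2)] by (simp add: cmod_power2) (simp add: power2_eq_square)
next
  case False
  define p q k where "p = Re (\<rho> x x)" and "q = Re (\<rho> y y)" and "k = (cmod (\<rho> x y))\<^sup>2"
  have nn: "p \<ge> 0" "q \<ge> 0" "k \<ge> 0"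
    using psd_diag(1)[OF assms(1)] assms(2,3) by (auto simp: p_def q_def k_def)
  \<comment> \<open>The form at the vector with entries \<open>s\<close> and
    \<open>- u * cnj (\<rho> x y)\<close>. The second entry absorbs the phase of
    \<open>\<rho> x y\<close>, so two real parameters suffice.\<close>
  have quad: "s\<^sup>2 * p - 2 * s * u * k + u\<^sup>2 * k * q \<ge> 0" for s u
  proof -
    have \<rho>: "\<rho> x x = of_real p" "\<rho> y y = of_real q" "\<rho> y x = cnj (\<rho> x y)"
      using psd_diag(2)[OF assms(1)] psd_hermitian[OF assms] assms(2,3)
      by (auto simp: p_def q_def complex_eq_iff)
    have k: "of_real k = \<rho> x y * cnj (\<rho> x y)"
      unfolding k_def by (rule complex_norm_square)
    have "complex_of_real (s\<^sup>2 * p - 2 * s * u * k + u\<^sup>2 * k * q) \<in> \<real>\<^sub>\<ge>\<^sub>0"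
      using psd_two_points[OF assms False, of "of_real s" "- of_real u * cnj (\<rho> x y)"]
      by (simp add: \<rho> k power2_eq_square algebra_simps)
    then show ?thesis by (simp only: complex_nonneg_Reals_iff Re_complex_of_real)
  qed
  have "k \<le> p * q"
  proof (cases "q = 0")
    case True
    have "k = 0"
    proof (rule ccontr)
      assume "k \<noteq> 0"
      \<comment> \<open>For \<open>q = 0\<close> this choice of \<open>u\<close> gives the form the
        value \<open>p - (p + 1) = -1\<close>.\<close>
      then show False using quad[of 1 "(p + 1) / (2 * k)"] True by simp
    qed
    then show ?thesis using nn by simp
  next
    case False
    have "q * (p * q - k) \<ge> 0"
      using quad[of q 1] by (simp add: power2_eq_square algebra_simps)
    then show ?thesis using False nn by (simp add: zero_le_mult_iff)
  qed
  then show ?thesis by (simp add: p_def q_def k_def)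
qed

lemma psd_zero_diag:
  assumes "psd X \<rho>" "x \<in> X" "y \<in> X" "Re (\<rho> x x) = 0"
  shows "\<rho> x y = 0" "\<rho> y x = 0"
  using psd_cauchy_schwarz[OF assms(1-3)] psd_hermitian[OF assms(1-3)] assms(4) by auto

text \<open>Cholesky factorisation, by induction on the Schur complement. It is what makes the trace of
  a product of two positive matrices visibly nonnegative.\<close>

lemma psd_finite_factor:
  assumes "finite F" "psd F \<rho>"
  shows "\<exists>V. \<forall>x\<in>F. \<forall>y\<in>F. \<rho> x y = (\<Sum>k\<in>F. V k x * cnj (V k y))"
  using assms
proof (induction F arbitrary: \<rho> rule: finite_induct)
  case (insert a F)
  note psd = insert.prems
  define p where "p = Re (\<rho> a a)"
  have p0: "p \<ge> 0" using psd_diag(1)[OF psd, of a] by (simp add: p_def)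
  have \<rho>aa: "\<rho> a a = of_real p"
    using psd_diag(2)[OF psd, of a] by (simp add: p_def complex_eq_iff)
  \<comment> \<open>The Schur complement of the pivot \<open>a\<close>. For \<open>p = 0\<close> the
    quotient is 0 by convention and \<sigma> is just \<rho>.\<close>
  define \<sigma> where "\<sigma> x y = \<rho> x y - \<rho> x a * \<rho> a y / p" for x y
  have "psd F \<sigma>"
  proof (rule psdI)
    fix G v assume G: "finite G" "G \<subseteq> F"
    then have aG: "a \<notin> G" using insert.hyps by auto
    define s where "s = (\<Sum>y\<in>G. \<rho> a y * v y)"
    have s': "cnj s = (\<Sum>x\<in>G. cnj (v x) * \<rho> x a)"
    proof -
      have "cnj s = (\<Sum>x\<in>G. cnj (\<rho> a x) * cnj (v x))" by (simp add: s_def)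
      also have "\<dots> = (\<Sum>x\<in>G. cnj (v x) * \<rho> x a)"
      proof (intro sum.cong refl)
        fix x assume "x \<in> G"
        then have "\<rho> x a = cnj (\<rho> a x)" using psd_hermitian[OF psd, of a x] G by auto
        then show "cnj (\<rho> a x) * cnj (v x) = cnj (v x) * \<rho> x a" by simp
      qed
      finally show ?thesis .
    qed
    have "(\<Sum>x\<in>G. \<Sum>y\<in>G. cnj (v x) * \<sigma> x y * v y)
        = (\<Sum>x\<in>G. \<Sum>y\<in>G. cnj (v x) * \<rho> x y * v y) - cnj s * s / p"
    proof -
      have "cnj s * s = (\<Sum>x\<in>G. \<Sum>y\<in>G. cnj (v x) * \<rho> x a * (\<rho> a y * v y))"
        unfolding s' unfolding s_def by (rule sum_product)
      then show ?thesis
        unfolding \<sigma>_def by (simp add: algebra_simps sum_subtractf sum_divide_distrib)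
    qed
    \<comment> \<open>Completing the square: for \<open>p > 0\<close>, among all extensions of
      \<open>v\<close> to \<open>a\<close> the entry \<open>- s / p\<close> minimises the form of
      \<rho>, and the minimum is the form of \<sigma>. For \<open>p = 0\<close> the entry is
      0.\<close>
    also have "\<dots> = (\<Sum>x\<in>insert a G. \<Sum>y\<in>insert a G.
        cnj (if x = a then - s / p else v x) * \<rho> x y * (if y = a then - s / p else v y))"
    proof -
      let ?v = "\<lambda>x. if x = a then - s / p else v x"
      have 1: "(\<Sum>y\<in>G. c * \<rho> a y * ?v y) = c * s" for c
        unfolding s_def sum_distrib_left using aG by (intro sum.cong refl) (auto simp: mult_ac)
      have 2: "(\<Sum>x\<in>G. cnj (?v x) * \<rho> x a * c) = cnj s * c" for c
        unfolding s' sum_distrib_right using aG by (intro sum.cong refl) (auto simp: mult_ac)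
      have 3: "(\<Sum>x\<in>G. \<Sum>y\<in>G. cnj (?v x) * \<rho> x y * ?v y) = (\<Sum>x\<in>G. \<Sum>y\<in>G. cnj (v x) * \<rho> x y * v y)"
        using aG by (intro sum.cong refl) auto
      have "(\<Sum>x\<in>insert a G. \<Sum>y\<in>insert a G. cnj (?v x) * \<rho> x y * ?v y)
        = cnj (?v a) * \<rho> a a * ?v a + (\<Sum>x\<in>G. cnj (?v x) * \<rho> x a * ?v a)
          + ((\<Sum>y\<in>G. cnj (?v a) * \<rho> a y * ?v y) + (\<Sum>x\<in>G. \<Sum>y\<in>G. cnj (?v x) * \<rho> x y * ?v y))"
        using G aG by (simp only: sum.insert sum.distrib finite_insert not_False_eq_True)
      also have "\<dots> = (\<Sum>x\<in>G. \<Sum>y\<in>G. cnj (v x) * \<rho> x y * v y) - cnj s * s / p"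
        unfolding 1 2 3 by (cases "p = 0") (simp_all add: \<rho>aa field_simps)
      finally show ?thesis by simp
    qed
    also have "\<dots> \<in> \<real>\<^sub>\<ge>\<^sub>0"
      by (rule psdD[OF psd]) (use G in auto)
    finally show "(\<Sum>x\<in>G. \<Sum>y\<in>G. cnj (v x) * \<sigma> x y * v y) \<in> \<real>\<^sub>\<ge>\<^sub>0" .
  qed
  then obtain V where V: "\<And>x y. x \<in> F \<Longrightarrow> y \<in> F \<Longrightarrow> \<sigma> x y = (\<Sum>k\<in>F. V k x * cnj (V k y))"
    using insert.IH by blast
  \<comment> \<open>The outer square of the new vector \<open>\<rho> x a / sqrt p\<close> is exactly
    what the Schur complement subtracted; the old vectors are made to vanish at
    \<open>a\<close>.\<close>
  define W where "W k x = (if k = a then \<rho> x a / sqrt p else if x = a then 0 else V k x)" for k x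
  have Wa: "W a x * cnj (W a y) = \<rho> x a * \<rho> a y / p" if "y \<in> insert a F" for x y
  proof -
    have "complex_of_real (sqrt p) * complex_of_real (sqrt p) = of_real p"
      using p0 by (simp flip: of_real_mult)
    then show ?thesis
      using psd_hermitian[OF psd that, of a] by (simp add: W_def)
  qed
  have "\<rho> x y = (\<Sum>k\<in>insert a F. W k x * cnj (W k y))" if xy: "x \<in> insert a F" "y \<in> insert a F" for x y
  proof (cases "x = a \<or> y = a")
    case True
    have "(\<Sum>k\<in>F. W k x * cnj (W k y)) = 0"
      using True insert.hyps by (intro sum.neutral) (auto simp: W_def)
    moreover have "\<rho> x a * \<rho> a y / p = \<rho> x y"
    \<comment> \<open>A vanishing pivot forces its whole row and column to vanish, so the quotient
      convention again gives the right value.\<close>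
    proof (cases "p = 0")
      case p: True
      then have "\<rho> a y = 0" "\<rho> x a = 0"
        using psd_zero_diag(1)[OF psd _ xy(2), of a] psd_zero_diag(2)[OF psd _ xy(1), of a]
        by (simp_all add: p_def)
      then have "\<rho> x y = 0" using True by blast
      then show ?thesis by (simp add: p)
    next
      case False
      then show ?thesis using True by (elim disjE) (simp_all add: \<rho>aa)
    qed
    ultimately show ?thesis using insert.hyps Wa[OF xy(2), of x] by simp
  next
    case False
    then have F: "x \<in> F" "y \<in> F" using xy by auto
    have "(\<Sum>k\<in>F. W k x * cnj (W k y)) = \<sigma> x y"
      unfolding V[OF F] using False insert.hyps by (intro sum.cong refl) (auto simp: W_def)
    then show ?thesis using insert.hyps Wa[OF xy(2), of x] by (simp add: \<sigma>_def)
  qed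
  then show ?case by blast
qed auto

text \<open>On \<open>F\<close> the matrix is
  \<open>\<Sum>\<^sub>k v\<^sub>k v\<^sub>k\<^sup>\<dagger>\<close>, so the two sides become sums of
  \<open>\<parallel>A v\<^sub>k\<parallel>\<^sup>2\<close> and of
  \<open>\<parallel>v\<^sub>k\<parallel>\<^sup>2\<close>.\<close>

lemma psd_contraction_trace_le:
  assumes A: "contraction R X A" and \<rho>: "psd X \<rho>"
    and F: "finite F" "F \<subseteq> X" and G: "finite G" "G \<subseteq> R"
  shows "Re (\<Sum>r\<in>G. \<Sum>w\<in>F. \<Sum>z\<in>F. A r w * \<rho> w z * cnj (A r z)) \<le> (\<Sum>w\<in>F. Re (\<rho> w w))"
proof -
  obtain V where V: "\<And>x y. x \<in> F \<Longrightarrow> y \<in> F \<Longrightarrow> \<rho> x y = (\<Sum>k\<in>F. V k x * cnj (V k y))"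
    using psd_finite_factor[OF F(1) psd_subset[OF \<rho> F(2)]] by blast
  have diag: "\<rho> w w = complex_of_real (\<Sum>k\<in>F. (cmod (V k w))\<^sup>2)" if "w \<in> F" for w
    unfolding V[OF that that] of_real_sum complex_norm_square ..
  have inner: "(\<Sum>w\<in>F. \<Sum>z\<in>F. A r w * \<rho> w z * cnj (A r z))
      = complex_of_real (\<Sum>k\<in>F. (cmod (\<Sum>w\<in>F. A r w * V k w))\<^sup>2)" for r
  proof -
    have "(\<Sum>w\<in>F. \<Sum>z\<in>F. A r w * \<rho> w z * cnj (A r z))
        = (\<Sum>w\<in>F. \<Sum>z\<in>F. \<Sum>k\<in>F. (A r w * V k w) * cnj (A r z * V k z))"
      by (intro sum.cong refl) (simp add: V sum_distrib_left sum_distrib_right mult_ac)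
    also have "\<dots> = (\<Sum>k\<in>F. \<Sum>w\<in>F. \<Sum>z\<in>F. (A r w * V k w) * cnj (A r z * V k z))"
      by (subst sum.swap[of _ _ F], subst (2) sum.swap, subst sum.swap, rule sum.cong[OF refl], rule sum.swap)
    also have "\<dots> = (\<Sum>k\<in>F. (\<Sum>w\<in>F. A r w * V k w) * cnj (\<Sum>w\<in>F. A r w * V k w))"
      by (simp only: cnj_sum sum_product)
    finally show ?thesis by (simp only: of_real_sum complex_norm_square)
  qed
  have "Re (\<Sum>r\<in>G. \<Sum>w\<in>F. \<Sum>z\<in>F. A r w * \<rho> w z * cnj (A r z))
      = (\<Sum>r\<in>G. \<Sum>k\<in>F. (cmod (\<Sum>w\<in>F. A r w * V k w))\<^sup>2)"
    unfolding inner by (simp only: Re_sum Re_complex_of_real)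
  also have "\<dots> = (\<Sum>k\<in>F. \<Sum>r\<in>G. (cmod (\<Sum>w\<in>F. A r w * V k w))\<^sup>2)"
    by (rule sum.swap)
  also have "\<dots> \<le> (\<Sum>k\<in>F. \<Sum>w\<in>F. (cmod (V k w))\<^sup>2)"
    by (intro sum_mono contractionD[OF A G F])
  also have "\<dots> = (\<Sum>w\<in>F. \<Sum>k\<in>F. (cmod (V k w))\<^sup>2)"
    by (rule sum.swap)
  also have "\<dots> = (\<Sum>w\<in>F. Re (\<rho> w w))"
    by (intro sum.cong refl) (simp add: diag)
  finally show ?thesis .
qed

section \<open>Positive trace class matrices\<close>

definition positive_trace_class :: "'a set \<Rightarrow> 'a mat \<Rightarrow> bool" where
  "positive_trace_class X \<rho> \<longleftrightarrow> psd X \<rho> \<and> (\<lambda>x. Re (\<rho> x x)) summable_on X"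

definition trace :: "'a set \<Rightarrow> 'a mat \<Rightarrow> real" where
  "trace X \<rho> = (\<Sum>\<^sub>\<infinity>x\<in>X. Re (\<rho> x x))"

lemma positive_trace_class_psd: "positive_trace_class X \<rho> \<Longrightarrow> psd X \<rho>"
  and positive_trace_class_summable: "positive_trace_class X \<rho> \<Longrightarrow> (\<lambda>x. Re (\<rho> x x)) summable_on X"
  by (simp_all add: positive_trace_class_def)

lemma psd_cong:
  assumes "\<And>x y. x \<in> X \<Longrightarrow> y \<in> X \<Longrightarrow> \<rho> x y = \<sigma> x y"
  shows "psd X \<rho> = psd X \<sigma>"
proof -
  have "(\<Sum>x\<in>F. \<Sum>y\<in>F. cnj (v x) * \<rho> x y * v y) = (\<Sum>x\<in>F. \<Sum>y\<in>F. cnj (v x) * \<sigma> x y * v y)"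
    if "F \<subseteq> X" for F v
    using that assms by (intro sum.cong refl) (metis subsetD)
  then show ?thesis unfolding psd_def by force
qed

lemma trace_cong: "(\<And>x. x \<in> X \<Longrightarrow> \<rho> x x = \<sigma> x x) \<Longrightarrow> trace X \<rho> = trace X \<sigma>"
  unfolding trace_def by (intro infsum_cong) auto

lemma psd_reindex:
  assumes \<rho>: "psd X \<rho>" and f: "inj_on f Y" "f ` Y \<subseteq> X"
  shows "psd Y (\<lambda>x y. \<rho> (f x) (f y))"
proof (rule psdI)
  fix F v assume F: "finite F" "F \<subseteq> Y"
  have inj: "inj_on f F" using f(1) F(2) by (rule inj_on_subset)
  have "(\<Sum>x\<in>f ` F. \<Sum>y\<in>f ` F. cnj (v (inv_into F f x)) * \<rho> x y * v (inv_into F f y)) \<in> \<real>\<^sub>\<ge>\<^sub>0"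
    by (rule psdD[OF \<rho>]) (use F f in auto)
  then show "(\<Sum>x\<in>F. \<Sum>y\<in>F. cnj (v x) * \<rho> (f x) (f y) * v y) \<in> \<real>\<^sub>\<ge>\<^sub>0"
    using inj by (simp add: sum.reindex inv_into_f_f)
qed

lemma trace_nonneg: "positive_trace_class X \<rho> \<Longrightarrow> trace X \<rho> \<ge> 0"
  unfolding trace_def by (intro infsum_nonneg psd_diag(1)[OF positive_trace_class_psd])

lemma diag_le_trace:
  assumes \<rho>: "positive_trace_class X \<rho>" and x: "x \<in> X"
  shows "Re (\<rho> x x) \<le> trace X \<rho>"
proof -
  have "(\<Sum>x\<in>{x}. Re (\<rho> x x)) \<le> trace X \<rho>"
    unfolding trace_def using x positive_trace_class_summable[OF \<rho>]
      psd_diag(1)[OF positive_trace_class_psd[OF \<rho>]]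
    by (intro finite_sum_le_infsum) auto
  then show ?thesis by simp
qed

text \<open>This reduces convergence of a series of states, entry by entry, to convergence of the
  numerical series of their traces.\<close>

lemma cmod_entry_le_trace:
  assumes \<rho>: "positive_trace_class X \<rho>" and xy: "x \<in> X" "y \<in> X"
  shows "cmod (\<rho> x y) \<le> trace X \<rho>"
proof (rule power2_le_imp_le[OF _ trace_nonneg[OF \<rho>]])
  have "(cmod (\<rho> x y))\<^sup>2 \<le> Re (\<rho> x x) * Re (\<rho> y y)"
    by (rule psd_cauchy_schwarz[OF positive_trace_class_psd[OF \<rho>] xy])
  also have "\<dots> \<le> trace X \<rho> * trace X \<rho>"
    using xy psd_diag(1)[OF positive_trace_class_psd[OF \<rho>]]
    by (intro mult_mono diag_le_trace[OF \<rho>] trace_nonneg[OF \<rho>]) auto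
  finally show "(cmod (\<rho> x y))\<^sup>2 \<le> (trace X \<rho>)\<^sup>2" by (simp add: power2_eq_square)
qed

lemma row_norm_le:
  assumes \<rho>: "positive_trace_class X \<rho>" and x: "x \<in> X"
  shows "sq_summable X (\<rho> x)" "(\<Sum>\<^sub>\<infinity>y\<in>X. (cmod (\<rho> x y))\<^sup>2) \<le> Re (\<rho> x x) * trace X \<rho>"
proof -
  have le: "(cmod (\<rho> x y))\<^sup>2 \<le> Re (\<rho> x x) * Re (\<rho> y y)" if "y \<in> X" for y
    by (rule psd_cauchy_schwarz[OF positive_trace_class_psd[OF \<rho>] x that])
  have sm: "(\<lambda>y. Re (\<rho> x x) * Re (\<rho> y y)) summable_on X"
    by (intro summable_on_cmult_right positive_trace_class_summable[OF \<rho>])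
  show sq: "sq_summable X (\<rho> x)"
    unfolding sq_summable_def by (rule summable_on_comparison_test[OF sm le]) auto
  have "(\<Sum>\<^sub>\<infinity>y\<in>X. (cmod (\<rho> x y))\<^sup>2) \<le> (\<Sum>\<^sub>\<infinity>y\<in>X. Re (\<rho> x x) * Re (\<rho> y y))"
    by (rule infsum_mono[OF sq[unfolded sq_summable_def] sm le])
  then show "(\<Sum>\<^sub>\<infinity>y\<in>X. (cmod (\<rho> x y))\<^sup>2) \<le> Re (\<rho> x x) * trace X \<rho>"
    by (simp add: infsum_cmult_right' trace_def)
qed

section \<open>Absolute convergence and the sandwiches
  \<open>A \<rho> A\<^sup>\<dagger>\<close>\<close>

lemma summable_on_Times_mult:
  fixes f :: "'a \<Rightarrow> real" and g :: "'b \<Rightarrow> real"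
  assumes f: "f summable_on X" and g: "g summable_on Y"
    and nn: "\<And>x. x \<in> X \<Longrightarrow> f x \<ge> 0" "\<And>y. y \<in> Y \<Longrightarrow> g y \<ge> 0"
  shows "(\<lambda>(x, y). f x * g y) summable_on X \<times> Y"
proof (rule summable_on_SigmaI)
  show "((\<lambda>y. case (x, y) of (x, y) \<Rightarrow> f x * g y) has_sum f x * infsum g Y) Y" for x
    by (simp add: has_sum_cmult_right g)
  show "(\<lambda>x. f x * infsum g Y) summable_on X"
    by (intro summable_on_cmult_left f)
qed (use nn in auto)

text \<open>\<open>|\<rho> w z| \<le> r w * r z\<close>, where \<open>r\<close> is the square root
  of the diagonal and is square summable because the trace is finite. The double series is therefore
  dominated by a product of two convergent series, which licenses every later exchange of the two
  sums.\<close>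

lemma quadratic_form_summable:
  assumes \<rho>: "positive_trace_class X \<rho>" and a: "sq_summable X a" and b: "sq_summable X b"
  shows "(\<lambda>(w, z). a w * \<rho> w z * b z) summable_on X \<times> X"
proof -
  define r where "r w = complex_of_real (sqrt (Re (\<rho> w w)))" for w
  have nn: "Re (\<rho> w w) \<ge> 0" if "w \<in> X" for w
    by (rule psd_diag(1)[OF positive_trace_class_psd[OF \<rho>] that])
  have "sq_summable X r"
    unfolding sq_summable_def
    by (subst summable_on_cong[where g="\<lambda>x. Re (\<rho> x x)"])
      (use nn positive_trace_class_summable[OF \<rho>] in \<open>auto simp: r_def\<close>)
  then have "(\<lambda>(w, z). norm (a w * r w) * norm (b z * r z)) summable_on X \<times> X"
    by (intro summable_on_Times_mult sq_summable_abs_mult a b) auto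
  then have "(\<lambda>p. norm (case p of (w, z) \<Rightarrow> a w * \<rho> w z * b z)) summable_on X \<times> X"
  proof (rule summable_on_comparison_test)
    fix p assume "p \<in> X \<times> X"
    then obtain w z where p: "p = (w, z)" "w \<in> X" "z \<in> X" by auto
    have "cmod (\<rho> w z) \<le> sqrt (Re (\<rho> w w) * Re (\<rho> z z))"
      by (rule real_le_rsqrt, rule psd_cauchy_schwarz[OF positive_trace_class_psd[OF \<rho>] p(2,3)])
    also have "\<dots> = cmod (r w) * cmod (r z)"
      using nn p by (simp add: r_def real_sqrt_mult)
    finally have "cmod (a w) * cmod (b z) * cmod (\<rho> w z) \<le> cmod (a w) * cmod (b z) * (cmod (r w) * cmod (r z))"
      by (intro mult_left_mono) auto
    then show "norm (case p of (w, z) \<Rightarrow> a w * \<rho> w z * b z)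
        \<le> (case p of (w, z) \<Rightarrow> norm (a w * r w) * norm (b z * r z))"
      by (simp add: p norm_mult mult_ac)
  qed auto
  then show ?thesis by (rule abs_summable_summable)
qed

text \<open>\<open>conj_by\<close> is a nested sum in one particular order; absolute convergence
  turns it into a sum over pairs and into the opposite nesting.\<close>

lemma conj_by_eq_infsum:
  assumes \<rho>: "positive_trace_class X \<rho>" and a: "sq_summable X (A x)" "sq_summable X (A y)"
  shows "conj_by X A \<rho> x y = (\<Sum>\<^sub>\<infinity>(w, z)\<in>X \<times> X. A x w * \<rho> w z * cnj (A y z))"
    and "conj_by X A \<rho> x y = (\<Sum>\<^sub>\<infinity>w\<in>X. A x w * (\<Sum>\<^sub>\<infinity>z\<in>X. \<rho> w z * cnj (A y z)))"
proof -
  have sm: "(\<lambda>(w, z). A x w * \<rho> w z * cnj (A y z)) summable_on X \<times> X"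
    by (rule quadratic_form_summable[OF \<rho>]) (use a in auto)
  have eq: "conj_by X A \<rho> x y = (\<Sum>\<^sub>\<infinity>z\<in>X. \<Sum>\<^sub>\<infinity>w\<in>X. A x w * \<rho> w z * cnj (A y z))"
    by (simp add: conj_by_def mat_mult_def adjoint_mat_def infsum_cmult_left')
  also have "\<dots> = (\<Sum>\<^sub>\<infinity>w\<in>X. \<Sum>\<^sub>\<infinity>z\<in>X. A x w * \<rho> w z * cnj (A y z))"
    by (rule infsum_swap_banach[OF sm, symmetric])
  finally have *: "conj_by X A \<rho> x y = (\<Sum>\<^sub>\<infinity>w\<in>X. \<Sum>\<^sub>\<infinity>z\<in>X. A x w * \<rho> w z * cnj (A y z))" .
  show "conj_by X A \<rho> x y = (\<Sum>\<^sub>\<infinity>(w, z)\<in>X \<times> X. A x w * \<rho> w z * cnj (A y z))"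
    unfolding * by (rule infsum_Sigma'_banach[OF sm])
  show "conj_by X A \<rho> x y = (\<Sum>\<^sub>\<infinity>w\<in>X. A x w * (\<Sum>\<^sub>\<infinity>z\<in>X. \<rho> w z * cnj (A y z)))"
    unfolding * mult.assoc infsum_cmult_right' ..
qed

text \<open>The squares \<open>F \<times> F\<close> are cofinal among the finite subsets of
  \<open>X \<times> X\<close>. Positivity is available on squares only, so limits have to be taken
  along them.\<close>

lemma has_sum_Times_tendsto_squares:
  assumes "(f has_sum S) (X \<times> X)"
  shows "((\<lambda>F. \<Sum>x\<in>F. \<Sum>y\<in>F. f (x, y)) \<longlongrightarrow> S) (finite_subsets_at_top X)"
proof -
  have "filterlim (\<lambda>F. F \<times> F) (finite_subsets_at_top (X \<times> X)) (finite_subsets_at_top X)"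
    unfolding filterlim_finite_subsets_at_top
  proof safe
    fix Y :: "('a \<times> 'a) set" assume Y: "finite Y" "Y \<subseteq> X \<times> X"
    have "\<forall>\<^sub>F F in finite_subsets_at_top X. finite F \<and> fst ` Y \<union> snd ` Y \<subseteq> F \<and> F \<subseteq> X"
      by (subst eventually_finite_subsets_at_top, rule exI[of _ "fst ` Y \<union> snd ` Y"]) (use Y in auto)
    then show "\<forall>\<^sub>F F in finite_subsets_at_top X. finite (F \<times> F) \<and> Y \<subseteq> F \<times> F \<and> F \<times> F \<subseteq> X \<times> X"
      by eventually_elim (force intro: rev_image_eqI)
  qed
  from filterlim_compose[OF assms[unfolded has_sum_def] this]
  show ?thesis by (simp add: sum.cartesian_product)
qed

text \<open>\<open>A \<rho> A\<^sup>\<dagger>\<close> for a rectangular matrix \<open>A\<close>. Stacking a family of Kraus operators into one such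
  matrix makes the trace bound for the family an instance of the bound for a single contraction.\<close>

definition sandwich :: "'a set \<Rightarrow> ('r \<Rightarrow> 'a \<Rightarrow> complex) \<Rightarrow> 'a mat \<Rightarrow> 'r mat" where
  "sandwich X A \<rho> = (\<lambda>r r'. \<Sum>\<^sub>\<infinity>(w, z)\<in>X \<times> X. A r w * \<rho> w z * cnj (A r' z))"

text \<open>The form of \<open>A \<rho> A\<^sup>\<dagger>\<close> at \<open>v\<close> is the form of
  \<rho> at \<open>u = A\<^sup>\<dagger> v\<close>, which is a limit of forms on finite squares; the
  nonnegative reals are closed.\<close>

lemma sandwich_psd:
  assumes A: "contraction R X A" and \<rho>: "positive_trace_class X \<rho>"
  shows "psd R (sandwich X A \<rho>)"
proof (rule psdI)
  fix F v assume F: "finite F" "F \<subseteq> R"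
  define u where "u z = (\<Sum>r\<in>F. cnj (A r z) * v r)" for z
  have "((\<lambda>p. \<Sum>r\<in>F. \<Sum>r'\<in>F. cnj (v r) * (case p of (w, z) \<Rightarrow> A r w * \<rho> w z * cnj (A r' z)) * v r')
     has_sum (\<Sum>r\<in>F. \<Sum>r'\<in>F. cnj (v r) * sandwich X A \<rho> r r' * v r')) (X \<times> X)"
    unfolding sandwich_def
    by (intro has_sum_sum has_sum_cmult_left has_sum_cmult_right has_sum_infsum quadratic_form_summable[OF \<rho>])
      (use F contraction_row[OF A] in auto)
  also have "(\<lambda>p. \<Sum>r\<in>F. \<Sum>r'\<in>F. cnj (v r) * (case p of (w, z) \<Rightarrow> A r w * \<rho> w z * cnj (A r' z)) * v r')
      = (\<lambda>p. case p of (w, z) \<Rightarrow> cnj (u w) * \<rho> w z * u z)"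
    by (rule ext, clarsimp simp: u_def sum_distrib_left sum_distrib_right)
      (subst sum.swap, simp add: mult_ac)
  finally have "((\<lambda>G. \<Sum>w\<in>G. \<Sum>z\<in>G. cnj (u w) * \<rho> w z * u z) \<longlongrightarrow>
      (\<Sum>r\<in>F. \<Sum>r'\<in>F. cnj (v r) * sandwich X A \<rho> r r' * v r')) (finite_subsets_at_top X)"
    by (drule_tac has_sum_Times_tendsto_squares) simp
  then show "(\<Sum>r\<in>F. \<Sum>r'\<in>F. cnj (v r) * sandwich X A \<rho> r r' * v r') \<in> \<real>\<^sub>\<ge>\<^sub>0"
    by (rule Lim_in_closed_set[OF closed_nonneg_Reals_complex, rotated 2])
      (auto intro!: eventually_finite_subsets_at_top_weakI psdD[OF positive_trace_class_psd[OF \<rho>]])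
qed

lemma sandwich_finite_trace_le:
  assumes A: "contraction R X A" and \<rho>: "positive_trace_class X \<rho>" and G: "finite G" "G \<subseteq> R"
  shows "(\<Sum>r\<in>G. Re (sandwich X A \<rho> r r)) \<le> trace X \<rho>"
proof (rule tendsto_le[OF finite_subsets_at_top_neq_bot])
  have "((\<lambda>p. \<Sum>r\<in>G. (case p of (w, z) \<Rightarrow> A r w * \<rho> w z * cnj (A r z)))
     has_sum (\<Sum>r\<in>G. sandwich X A \<rho> r r)) (X \<times> X)"
    unfolding sandwich_def
    by (intro has_sum_sum has_sum_infsum quadratic_form_summable[OF \<rho>])
      (use G contraction_row[OF A] in auto)
  from tendsto_Re[OF has_sum_Times_tendsto_squares[OF this]]
  show "((\<lambda>F. Re (\<Sum>w\<in>F. \<Sum>z\<in>F. \<Sum>r\<in>G. A r w * \<rho> w z * cnj (A r z))) \<longlongrightarrow>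
     (\<Sum>r\<in>G. Re (sandwich X A \<rho> r r))) (finite_subsets_at_top X)"
    by simp
  show "((\<lambda>F. \<Sum>w\<in>F. Re (\<rho> w w)) \<longlongrightarrow> trace X \<rho>) (finite_subsets_at_top X)"
    unfolding trace_def by (rule infsum_tendsto[OF positive_trace_class_summable[OF \<rho>]])
  show "\<forall>\<^sub>F F in finite_subsets_at_top X.
      Re (\<Sum>w\<in>F. \<Sum>z\<in>F. \<Sum>r\<in>G. A r w * \<rho> w z * cnj (A r z)) \<le> (\<Sum>w\<in>F. Re (\<rho> w w))"
  proof (rule eventually_finite_subsets_at_top_weakI)
    fix F assume F: "finite F" "F \<subseteq> X"
    have "(\<Sum>w\<in>F. \<Sum>z\<in>F. \<Sum>r\<in>G. A r w * \<rho> w z * cnj (A r z))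
        = (\<Sum>r\<in>G. \<Sum>w\<in>F. \<Sum>z\<in>F. A r w * \<rho> w z * cnj (A r z))"
      by (rule trans[OF sum.cong[OF refl sum.swap] sum.swap])
    then show "Re (\<Sum>w\<in>F. \<Sum>z\<in>F. \<Sum>r\<in>G. A r w * \<rho> w z * cnj (A r z)) \<le> (\<Sum>w\<in>F. Re (\<rho> w w))"
      using psd_contraction_trace_le[OF A positive_trace_class_psd[OF \<rho>] F G] by simp
  qed
qed

lemma sandwich_positive_trace_class:
  assumes A: "contraction R X A" and \<rho>: "positive_trace_class X \<rho>"
  shows "positive_trace_class R (sandwich X A \<rho>)" "trace R (sandwich X A \<rho>) \<le> trace X \<rho>"
proof -
  have "(\<lambda>r. Re (sandwich X A \<rho> r r)) summable_on R"
    by (rule nonneg_bdd_above_summable_on)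
      (auto intro!: psd_diag(1)[OF sandwich_psd[OF assms]] bdd_aboveI2 sandwich_finite_trace_le[OF assms])
  then show "positive_trace_class R (sandwich X A \<rho>)" "trace R (sandwich X A \<rho>) \<le> trace X \<rho>"
    unfolding positive_trace_class_def trace_def
    by (auto intro!: sandwich_psd[OF assms] infsum_le_finite_sums sandwich_finite_trace_le[OF assms, unfolded trace_def])
qed

text \<open>Up to renaming indices, \<open>conj_by X (A m) \<rho>\<close> is the \<open>m\<close>-th
  diagonal block of the sandwich with the stacked matrix. Fubini on the diagonal writes the trace of
  that sandwich as the sum of the traces of its blocks.\<close>

lemma kraus_positive_trace_class:
  assumes A: "contraction (I \<times> X) X (\<lambda>(m, x). A m x)" and \<rho>: "positive_trace_class X \<rho>"
  shows "m \<in> I \<Longrightarrow> positive_trace_class X (conj_by X (A m) \<rho>)"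
    and "(\<lambda>m. trace X (conj_by X (A m) \<rho>)) summable_on I"
    and "(\<Sum>\<^sub>\<infinity>m\<in>I. trace X (conj_by X (A m) \<rho>)) \<le> trace X \<rho>"
proof -
  define S where "S = sandwich X (\<lambda>(m, x). A m x) \<rho>"
  have S: "positive_trace_class (I \<times> X) S" "trace (I \<times> X) S \<le> trace X \<rho>"
    unfolding S_def by (rule sandwich_positive_trace_class[OF A \<rho>])+
  have eq: "conj_by X (A m) \<rho> x y = S (m, x) (m, y)" if "m \<in> I" "x \<in> X" "y \<in> X" for m x y
    using conj_by_eq_infsum(1)[OF \<rho>, of "A m" x y] contraction_row[OF A] that
    by (auto simp: S_def sandwich_def)
  have sm: "(\<lambda>(m, x). Re (S (m, x) (m, x))) summable_on I \<times> X"
    using positive_trace_class_summable[OF S(1)] by (simp add: case_prod_unfold)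
  have tr: "trace X (conj_by X (A m) \<rho>) = (\<Sum>\<^sub>\<infinity>x\<in>X. Re (S (m, x) (m, x)))" if "m \<in> I" for m
    unfolding trace_def using eq that by (intro infsum_cong) auto
  show "positive_trace_class X (conj_by X (A m) \<rho>)" if "m \<in> I"
    unfolding positive_trace_class_def
  proof
    have "psd X (\<lambda>x y. S (m, x) (m, y))"
      by (rule psd_reindex[OF positive_trace_class_psd[OF S(1)]]) (use that in \<open>auto simp: inj_on_def\<close>)
    then show "psd X (conj_by X (A m) \<rho>)"
      using psd_cong[of X "conj_by X (A m) \<rho>" "\<lambda>x y. S (m, x) (m, y)"] eq that by simp
    have "(\<lambda>x. Re (S (m, x) (m, x))) summable_on X"
      using summable_on_SigmaD1[OF sm that] by simp
    then show "(\<lambda>x. Re (conj_by X (A m) \<rho> x x)) summable_on X"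
      using summable_on_cong[of X "\<lambda>x. Re (conj_by X (A m) \<rho> x x)" "\<lambda>x. Re (S (m, x) (m, x))"] eq that
      by simp
  qed
  show "(\<lambda>m. trace X (conj_by X (A m) \<rho>)) summable_on I"
    using iffD2[OF summable_on_cong[OF tr] summable_on_Sigma_banach[OF sm]] by simp
  have "(\<Sum>\<^sub>\<infinity>m\<in>I. trace X (conj_by X (A m) \<rho>)) = trace (I \<times> X) S"
    using trans[OF infsum_cong[OF tr] infsum_Sigma'_banach[OF sm]]
    by (simp add: trace_def case_prod_unfold)
  then show "(\<Sum>\<^sub>\<infinity>m\<in>I. trace X (conj_by X (A m) \<rho>)) \<le> trace X \<rho>"
    using S(2) by simp
qed

text \<open>A single operator is a family over the one-point index set, so results on families
  specialise to it.\<close>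

lemma contraction_stack_single:
  "contraction ({()} \<times> R) S (\<lambda>(_, r). A r) \<longleftrightarrow> contraction R S A"
proof
  assume "contraction ({()} \<times> R) S (\<lambda>(_, r). A r)"
  then show "contraction R S A"
    by (rule contraction_reindex[where f="Pair ()" and g=id]) (auto simp: inj_on_def)
next
  assume "contraction R S A"
  then show "contraction ({()} \<times> R) S (\<lambda>(_, r). A r)"
    by (rule contraction_reindex[where f=snd and g=id]) (auto simp: inj_on_def)
qed

lemma contraction_stack_member:
  assumes "contraction (I \<times> R) S (\<lambda>(m, r). A m r)" "m \<in> I"
  shows "contraction R S (A m)"
  using assms(1) by (rule contraction_reindex[where f="Pair m" and g=id]) (use assms(2) in \<open>auto simp: inj_on_def\<close>)

lemma conj_by_positive_trace_class:
  assumes A: "contraction X X A" and \<rho>: "positive_trace_class X \<rho>"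
  shows "positive_trace_class X (conj_by X A \<rho>)" "trace X (conj_by X A \<rho>) \<le> trace X \<rho>"
  using kraus_positive_trace_class[of "{()}" X "\<lambda>_. A", OF _ \<rho>] A
  by (simp_all add: contraction_stack_single)

lemma sum_in_nonneg_Reals:
  fixes f :: "'a \<Rightarrow> complex"
  assumes "\<And>x. x \<in> F \<Longrightarrow> f x \<in> \<real>\<^sub>\<ge>\<^sub>0"
  shows "sum f F \<in> \<real>\<^sub>\<ge>\<^sub>0"
  using assms by (induction F rule: infinite_finite_induct) auto

text \<open>Entries are bounded by traces, so the entrywise series converge absolutely. Positivity
  of the finite forms and the bound on finite parts of the diagonal both survive the limit.\<close>

lemma infsum_positive_trace_class:
  assumes \<sigma>: "\<And>m. m \<in> I \<Longrightarrow> positive_trace_class X (\<sigma> m)"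
    and tr: "(\<lambda>m. trace X (\<sigma> m)) summable_on I"
  shows "x \<in> X \<Longrightarrow> y \<in> X \<Longrightarrow> (\<lambda>m. \<sigma> m x y) summable_on I"
    and "positive_trace_class X (\<lambda>x y. \<Sum>\<^sub>\<infinity>m\<in>I. \<sigma> m x y)"
    and "trace X (\<lambda>x y. \<Sum>\<^sub>\<infinity>m\<in>I. \<sigma> m x y) \<le> (\<Sum>\<^sub>\<infinity>m\<in>I. trace X (\<sigma> m))"
proof -
  show sm: "(\<lambda>m. \<sigma> m x y) summable_on I" if "x \<in> X" "y \<in> X" for x y
    by (rule abs_summable_summable, rule summable_on_comparison_test[OF tr])
      (use cmod_entry_le_trace[OF \<sigma>] that in auto)
  have psd: "psd X (\<lambda>x y. \<Sum>\<^sub>\<infinity>m\<in>I. \<sigma> m x y)"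
  proof (rule psdI)
    fix F v assume F: "finite F" "F \<subseteq> X"
    have "((\<lambda>m. \<Sum>x\<in>F. \<Sum>y\<in>F. cnj (v x) * \<sigma> m x y * v y) has_sum
        (\<Sum>x\<in>F. \<Sum>y\<in>F. cnj (v x) * (\<Sum>\<^sub>\<infinity>m\<in>I. \<sigma> m x y) * v y)) I"
      by (intro has_sum_sum has_sum_cmult_left has_sum_cmult_right has_sum_infsum sm) (use F in auto)
    then show "(\<Sum>x\<in>F. \<Sum>y\<in>F. cnj (v x) * (\<Sum>\<^sub>\<infinity>m\<in>I. \<sigma> m x y) * v y) \<in> \<real>\<^sub>\<ge>\<^sub>0"
      unfolding has_sum_def
      by (rule Lim_in_closed_set[OF closed_nonneg_Reals_complex, rotated 2])
        (rule eventually_finite_subsets_at_top_weakI, rule sum_in_nonneg_Reals,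
         auto intro!: psdD[OF positive_trace_class_psd[OF \<sigma>]] F)
  qed
  have fin: "(\<Sum>x\<in>F. Re (\<Sum>\<^sub>\<infinity>m\<in>I. \<sigma> m x x)) \<le> (\<Sum>\<^sub>\<infinity>m\<in>I. trace X (\<sigma> m))"
    if F: "finite F" "F \<subseteq> X" for F
  proof -
    have "((\<lambda>m. \<Sum>x\<in>F. \<sigma> m x x) has_sum (\<Sum>x\<in>F. \<Sum>\<^sub>\<infinity>m\<in>I. \<sigma> m x x)) I"
      by (intro has_sum_sum has_sum_infsum sm) (use F in auto)
    from has_sum_Re[OF this] have "((\<lambda>m. \<Sum>x\<in>F. Re (\<sigma> m x x)) has_sum (\<Sum>x\<in>F. Re (\<Sum>\<^sub>\<infinity>m\<in>I. \<sigma> m x x))) I"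
      by simp
    then show ?thesis
    proof (rule has_sum_mono[OF _ has_sum_infsum[OF tr]])
      fix m assume m: "m \<in> I"
      show "(\<Sum>x\<in>F. Re (\<sigma> m x x)) \<le> trace X (\<sigma> m)"
        unfolding trace_def
        by (rule finite_sum_le_infsum[OF positive_trace_class_summable[OF \<sigma>[OF m]] F])
          (use psd_diag(1)[OF positive_trace_class_psd[OF \<sigma>[OF m]]] in auto)
    qed
  qed
  have "(\<lambda>x. Re (\<Sum>\<^sub>\<infinity>m\<in>I. \<sigma> m x x)) summable_on X"
    by (rule nonneg_bdd_above_summable_on) (auto intro!: psd_diag(1)[OF psd] bdd_aboveI2 fin)
  then show "positive_trace_class X (\<lambda>x y. \<Sum>\<^sub>\<infinity>m\<in>I. \<sigma> m x y)"
    and "trace X (\<lambda>x y. \<Sum>\<^sub>\<infinity>m\<in>I. \<sigma> m x y) \<le> (\<Sum>\<^sub>\<infinity>m\<in>I. trace X (\<sigma> m))"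
    unfolding positive_trace_class_def trace_def
    by (auto intro!: psd infsum_le_finite_sums fin[unfolded trace_def])
qed

text \<open>From \<open>A \<sigma> = \<alpha> \<sigma>\<close> and self-adjointness of \<sigma>
  follows \<open>\<sigma> A\<^sup>\<dagger> = cnj \<alpha> \<sigma>\<close>; the two phases cancel
  since \<open>|\<alpha>| = 1\<close>.\<close>

lemma conj_by_fixed:
  assumes \<sigma>: "psd X \<sigma>" and \<alpha>: "cmod \<alpha> = 1"
    and eig: "\<And>x y. x \<in> X \<Longrightarrow> y \<in> X \<Longrightarrow> (\<Sum>\<^sub>\<infinity>u\<in>X. A x u * \<sigma> u y) = \<alpha> * \<sigma> x y"
    and xy: "x \<in> X" "y \<in> X"
  shows "conj_by X A \<sigma> x y = \<sigma> x y"
proof -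
  have "conj_by X A \<sigma> x y = (\<Sum>\<^sub>\<infinity>z\<in>X. \<alpha> * cnj (A y z * \<sigma> z x))"
    unfolding conj_by_def mat_mult_def adjoint_mat_def
    using xy by (intro infsum_cong) (simp add: eig psd_hermitian[OF \<sigma> xy(1)])
  also have "\<dots> = \<alpha> * cnj (\<alpha> * \<sigma> y x)"
    unfolding infsum_cmult_right' infsum_cnj eig[OF xy(2,1)] ..
  also have "\<dots> = (\<alpha> * cnj \<alpha>) * \<sigma> x y"
    by (simp add: psd_hermitian[OF \<sigma> xy])
  also have "\<alpha> * cnj \<alpha> = 1"
    using complex_norm_square[of \<alpha>] \<alpha> by simp
  finally show ?thesis by simp
qed

text \<open>If the outcome \<open>m\<close> leaves \<open>\<sigma>\<close> unchanged, it uses up the whole trace.\<close>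

lemma conj_by_eq_0:
  assumes A: "contraction (I \<times> X) X (\<lambda>(m, x). A m x)" and \<sigma>: "positive_trace_class X \<sigma>"
    and m: "m \<in> I" "m' \<in> I" "m \<noteq> m'"
    and fixed: "\<And>x y. x \<in> X \<Longrightarrow> y \<in> X \<Longrightarrow> conj_by X (A m) \<sigma> x y = \<sigma> x y"
    and xy: "x \<in> X" "y \<in> X"
  shows "conj_by X (A m') \<sigma> x y = 0"
proof -
  note K = kraus_positive_trace_class[OF A \<sigma>]
  have "(\<Sum>k\<in>{m, m'}. trace X (conj_by X (A k) \<sigma>)) \<le> (\<Sum>\<^sub>\<infinity>k\<in>I. trace X (conj_by X (A k) \<sigma>))"
    by (rule finite_sum_le_infsum[OF K(2)]) (use m trace_nonneg[OF K(1)] in auto)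
  also have "\<dots> \<le> trace X (conj_by X (A m) \<sigma>)"
    using K(3) trace_cong[of X "conj_by X (A m) \<sigma>" \<sigma>] fixed by simp
  finally have "trace X (conj_by X (A m') \<sigma>) \<le> 0" using m by simp
  then have "cmod (conj_by X (A m') \<sigma> x y) \<le> 0"
    using cmod_entry_le_trace[OF K(1)[OF m(2)] xy] by linarith
  then show ?thesis by simp
qed

text \<open>\<open>A (B \<rho> B\<^sup>\<dagger>) = (A B) \<rho> B\<^sup>\<dagger> = \<alpha> B
  \<rho> B\<^sup>\<dagger>\<close>. The reassociation is legitimate because \<tau>, the column
  \<open>y\<close> of \<open>\<rho> B\<^sup>\<dagger>\<close>, is square summable.\<close>

lemma conj_by_left_eigen:
  assumes A: "contraction X X A" and B: "contraction X X B" and \<rho>: "positive_trace_class X \<rho>"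
    and eig: "\<And>x y. x \<in> X \<Longrightarrow> y \<in> X \<Longrightarrow> mat_mult X A B x y = \<alpha> * B x y"
    and xy: "x \<in> X" "y \<in> X"
  shows "(\<Sum>\<^sub>\<infinity>u\<in>X. A x u * conj_by X B \<rho> u y) = \<alpha> * conj_by X B \<rho> x y"
proof -
  define \<tau> where "\<tau> w = (\<Sum>\<^sub>\<infinity>z\<in>X. \<rho> w z * cnj (B y z))" for w
  have conj: "conj_by X B \<rho> u y = (\<Sum>\<^sub>\<infinity>w\<in>X. B u w * \<tau> w)" if "u \<in> X" for u
    unfolding \<tau>_def by (rule conj_by_eq_infsum(2)[OF \<rho>]) (use contraction_row[OF B] that xy in auto)
  have "sq_summable X \<tau>"
    unfolding sq_summable_def
  proof (rule summable_on_comparison_test)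
    define c where "c = (\<Sum>\<^sub>\<infinity>z\<in>X. (cmod (B y z))\<^sup>2)"
    have c0: "c \<ge> 0" unfolding c_def by (intro infsum_nonneg) auto
    show "(\<lambda>w. Re (\<rho> w w) * (trace X \<rho> * c)) summable_on X"
      by (intro summable_on_cmult_left positive_trace_class_summable[OF \<rho>])
    fix w assume w: "w \<in> X"
    \<comment> \<open>Row \<open>w\<close> of \<rho> has squared norm at most
      \<open>Re (\<rho> w w) * trace X \<rho>\<close>, so Cauchy-Schwarz dominates the squares of
      \<tau> by a multiple of the diagonal of \<rho>.\<close>
    have "cmod (\<tau> w) \<le> sqrt (\<Sum>\<^sub>\<infinity>z\<in>X. (cmod (\<rho> w z))\<^sup>2) * sqrt (\<Sum>\<^sub>\<infinity>z\<in>X. (cmod (cnj (B y z)))\<^sup>2)"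
      unfolding \<tau>_def
      by (intro cmod_infsum_mult_le row_norm_le(1)[OF \<rho> w]) (use contraction_row[OF B xy(2)] in simp)
    also have "\<dots> \<le> sqrt (Re (\<rho> w w) * trace X \<rho>) * sqrt c"
      unfolding c_def
      using mult_nonneg_nonneg[OF psd_diag(1)[OF positive_trace_class_psd[OF \<rho>] w] trace_nonneg[OF \<rho>]]
      by (intro mult_mono real_sqrt_le_mono row_norm_le(2)[OF \<rho> w]) (simp_all add: infsum_nonneg)
    finally have "(cmod (\<tau> w))\<^sup>2 \<le> (sqrt (Re (\<rho> w w) * trace X \<rho>) * sqrt c)\<^sup>2"
      by (intro power_mono) auto
    also have "\<dots> = Re (\<rho> w w) * (trace X \<rho> * c)"
      using c0 mult_nonneg_nonneg[OF psd_diag(1)[OF positive_trace_class_psd[OF \<rho>] w] trace_nonneg[OF \<rho>]]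
      by (simp add: power_mult_distrib mult.assoc)
    finally show "(cmod (\<tau> w))\<^sup>2 \<le> Re (\<rho> w w) * (trace X \<rho> * c)" .
  qed auto
  then have "(\<Sum>\<^sub>\<infinity>w\<in>X. (\<Sum>\<^sub>\<infinity>u\<in>X. A x u * B u w) * \<tau> w) = (\<Sum>\<^sub>\<infinity>u\<in>X. A x u * (\<Sum>\<^sub>\<infinity>w\<in>X. B u w * \<tau> w))"
    by (rule contraction_assoc[OF B _ contraction_row[OF A xy(1)]])
  also have "\<dots> = (\<Sum>\<^sub>\<infinity>u\<in>X. A x u * conj_by X B \<rho> u y)"
    by (intro infsum_cong) (simp add: conj)
  finally have "(\<Sum>\<^sub>\<infinity>u\<in>X. A x u * conj_by X B \<rho> u y) = (\<Sum>\<^sub>\<infinity>w\<in>X. (\<Sum>\<^sub>\<infinity>u\<in>X. A x u * B u w) * \<tau> w)" ..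
  also have "\<dots> = (\<Sum>\<^sub>\<infinity>w\<in>X. \<alpha> * (B x w * \<tau> w))"
    using eig xy by (intro infsum_cong) (simp add: mat_mult_def)
  also have "\<dots> = \<alpha> * conj_by X B \<rho> x y"
    by (simp add: conj[OF xy(1)] infsum_cmult_right')
  finally show ?thesis .
qed

text \<open>Carries an eigenvalue relation from the terms of a series of states to its sum, by
  exchanging the sums over \<open>u\<close> and \<open>m\<close>. With \<open>s\<close> and
  \<open>t\<close> the roots of the diagonal entries at \<open>u\<close> and \<open>y\<close>, the
  majorant comes from \<open>|A x u| t s \<le> (|A x u| t)\<^sup>2 + s\<^sup>2\<close>: the first
  square sums along the row of \<open>A\<close>, the second along the diagonal.\<close>

lemma infsum_left_eigen:
  assumes A: "contraction X X A" and \<sigma>: "\<And>m. m \<in> I \<Longrightarrow> positive_trace_class X (\<sigma> m)"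
    and tr: "(\<lambda>m. trace X (\<sigma> m)) summable_on I"
    and eig: "\<And>m. m \<in> I \<Longrightarrow> (\<Sum>\<^sub>\<infinity>u\<in>X. A x u * \<sigma> m u y) = \<alpha> * \<sigma> m x y"
    and xy: "x \<in> X" "y \<in> X"
  shows "(\<Sum>\<^sub>\<infinity>u\<in>X. A x u * (\<Sum>\<^sub>\<infinity>m\<in>I. \<sigma> m u y)) = \<alpha> * (\<Sum>\<^sub>\<infinity>m\<in>I. \<sigma> m x y)"
proof -
  define c where "c = (\<Sum>\<^sub>\<infinity>u\<in>X. (cmod (A x u))\<^sup>2)"
  have "(\<lambda>(m, u). (cmod (A x u))\<^sup>2 * trace X (\<sigma> m) + Re (\<sigma> m u u)) summable_on I \<times> X"
  proof (rule summable_on_SigmaI)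
    show "((\<lambda>u. case (m, u) of (m, u) \<Rightarrow> (cmod (A x u))\<^sup>2 * trace X (\<sigma> m) + Re (\<sigma> m u u))
        has_sum c * trace X (\<sigma> m) + trace X (\<sigma> m)) X" if "m \<in> I" for m
      unfolding prod.case trace_def[of X "\<sigma> m"] c_def
      by (intro has_sum_add has_sum_cmult_left has_sum_infsum positive_trace_class_summable[OF \<sigma>[OF that]])
        (use contraction_row[OF A xy(1)] in \<open>simp add: sq_summable_def\<close>)
    show "(\<lambda>m. c * trace X (\<sigma> m) + trace X (\<sigma> m)) summable_on I"
      by (intro summable_on_add summable_on_cmult_right tr)
  qed (auto intro!: add_nonneg_nonneg mult_nonneg_nonneg trace_nonneg \<sigma> psd_diag(1)[OF positive_trace_class_psd[OF \<sigma>]])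
  then have "(\<lambda>p. norm (case p of (m, u) \<Rightarrow> A x u * \<sigma> m u y)) summable_on I \<times> X"
  proof (rule summable_on_comparison_test)
    fix p assume "p \<in> I \<times> X"
    then obtain m u where p: "p = (m, u)" "m \<in> I" "u \<in> X" by auto
    note \<sigma>m = positive_trace_class_psd[OF \<sigma>[OF p(2)]]
    define s t where "s = sqrt (Re (\<sigma> m u u))" and "t = sqrt (Re (\<sigma> m y y))"
    have st: "s \<ge> 0" "t \<ge> 0" "s\<^sup>2 = Re (\<sigma> m u u)" "t\<^sup>2 = Re (\<sigma> m y y)"
      using psd_diag(1)[OF \<sigma>m] p xy by (auto simp: s_def t_def)
    have "cmod (\<sigma> m u y) \<le> s * t"
    proof (rule power2_le_imp_le)
      show "(cmod (\<sigma> m u y))\<^sup>2 \<le> (s * t)\<^sup>2"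
        unfolding power_mult_distrib st(3,4) by (rule psd_cauchy_schwarz[OF \<sigma>m p(3) xy(2)])
    qed (use st in simp)
    then have "cmod (A x u) * cmod (\<sigma> m u y) \<le> (cmod (A x u) * t) * s"
      using mult_left_mono[of "cmod (\<sigma> m u y)" "s * t" "cmod (A x u)"] by (simp add: mult_ac)
    also have "\<dots> \<le> (cmod (A x u) * t)\<^sup>2 + s\<^sup>2"
      using sum_squares_bound[of "cmod (A x u) * t" s] mult_nonneg_nonneg[OF mult_nonneg_nonneg[OF norm_ge_zero st(2)] st(1), of "A x u"]
      by linarith
    also have "\<dots> = (cmod (A x u))\<^sup>2 * Re (\<sigma> m y y) + Re (\<sigma> m u u)"
      by (simp add: power_mult_distrib st)
    also have "\<dots> \<le> (cmod (A x u))\<^sup>2 * trace X (\<sigma> m) + Re (\<sigma> m u u)"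
      using diag_le_trace[OF \<sigma>[OF p(2)] xy(2)] by (intro add_mono mult_left_mono) auto
    finally show "norm (case p of (m, u) \<Rightarrow> A x u * \<sigma> m u y)
        \<le> (case p of (m, u) \<Rightarrow> (cmod (A x u))\<^sup>2 * trace X (\<sigma> m) + Re (\<sigma> m u u))"
      by (simp add: p norm_mult)
  qed auto
  then have sm: "(\<lambda>(m, u). A x u * \<sigma> m u y) summable_on I \<times> X"
    by (rule abs_summable_summable)
  have "(\<Sum>\<^sub>\<infinity>u\<in>X. A x u * (\<Sum>\<^sub>\<infinity>m\<in>I. \<sigma> m u y)) = (\<Sum>\<^sub>\<infinity>u\<in>X. \<Sum>\<^sub>\<infinity>m\<in>I. A x u * \<sigma> m u y)"
    by (simp add: infsum_cmult_right')
  also have "\<dots> = (\<Sum>\<^sub>\<infinity>m\<in>I. \<Sum>\<^sub>\<infinity>u\<in>X. A x u * \<sigma> m u y)"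
    by (rule infsum_swap_banach[OF sm, symmetric])
  also have "\<dots> = \<alpha> * (\<Sum>\<^sub>\<infinity>m\<in>I. \<sigma> m x y)"
    by (simp add: eig infsum_cmult_right' cong: infsum_cong)
  finally show ?thesis .
qed

section \<open>Operators of circuits and measurements\<close>

lemma map_configs_reg_basis: "c \<in> configs B e \<Longrightarrow> map c qs \<in> reg_basis B qs"
  by (auto simp: configs_def reg_basis_def list_all2_map1 list_all2_same)

lemma inj_on_map_configs:
  assumes "\<And>c c'. c \<in> D \<Longrightarrow> c' \<in> D \<Longrightarrow> (\<forall>q. q \<notin> set qs \<longrightarrow> c q = c' q)"
  shows "inj_on (\<lambda>c. map c qs) D"
proof (rule inj_onI, rule ext)
  fix c c' q assume "c \<in> D" "c' \<in> D" "map c qs = map c' qs"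
  then show "c q = c' q" using assms[of c c'] by (cases "q \<in> set qs") auto
qed

lemma extend_outside:
  "c \<notin> configs B e \<or> c' \<notin> configs B e \<Longrightarrow> extend B e qs A c c' = 0"
  by (auto simp: extend_def)

text \<open>\<open>A \<otimes> I\<close> is block diagonal: configurations with the same values off
  the register form a block, and reading off the register embeds each block into \<open>A\<close>.
  Extending the stacked family as a whole preserves its joint norm bound.\<close>

lemma contraction_extend_family:
  fixes B :: "'q \<Rightarrow> 'b set" and qs :: "'q list" and A :: "'m \<Rightarrow> 'b list mat"
  assumes A: "contraction (I \<times> reg_basis B qs) (reg_basis B qs) (\<lambda>(m, x). A m x)"
  shows "contraction (I \<times> configs B e) (configs B e) (\<lambda>(m, c). extend B e qs (A m) c)"
proof -
  \<comment> \<open>Overwriting the register by a dummy value yields a label that two configurations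
    share exactly when they agree off the register.\<close>
  define off :: "('q \<Rightarrow> 'b) \<Rightarrow> 'q \<Rightarrow> 'b" where "off c = (\<lambda>q. if q \<in> set qs then undefined else c q)" for c
  have off: "off c = off c' \<longleftrightarrow> (\<forall>q. q \<notin> set qs \<longrightarrow> c q = c' q)" for c c'
    by (auto simp: off_def fun_eq_iff)
  show ?thesis
  proof (rule contraction_block[where f="\<lambda>(m, c). off c" and g=off])
    show "(case r of (m, c) \<Rightarrow> extend B e qs (A m) c) s = 0" if "(case r of (m, c) \<Rightarrow> off c) \<noteq> off s" for r s
        using that by (cases r) (auto simp: off extend_def)
    fix k
    let ?R = "{r \<in> I \<times> configs B e. (case r of (m, c) \<Rightarrow> off c) = k}"
    let ?S = "{s \<in> configs B e. off s = k}"
    have inj: "inj_on (\<lambda>c. map c qs) ?S"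
      by (rule inj_on_map_configs) (use off in force)
    show "contraction ?R ?S (\<lambda>(m, c). extend B e qs (A m) c)"
    proof (rule contraction_reindex[OF A, where f="\<lambda>(m, c). (m, map c qs)" and g="\<lambda>c. map c qs"])
      show "inj_on (\<lambda>(m, c). (m, map c qs)) ?R"
        using inj_onD[OF inj] by (fastforce intro!: inj_onI)
      fix r s assume "r \<in> ?R" "s \<in> ?S"
      then obtain m c where r: "r = (m, c)" "c \<in> configs B e" "off c = k" and s: "s \<in> configs B e" "off s = k"
        by auto
      then have "\<forall>q. q \<notin> set qs \<longrightarrow> c q = s q" using off[of c s] by simp
      then show "(case r of (m, c) \<Rightarrow> extend B e qs (A m) c) s
          = (case case r of (m, c) \<Rightarrow> (m, map c qs) of (m, x) \<Rightarrow> A m x) (map s qs)"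
        using r s by (simp add: extend_def)
    qed (use inj map_configs_reg_basis in auto)
  qed
qed

lemma contraction_extend:
  assumes "contraction (reg_basis B qs) (reg_basis B qs) A"
  shows "contraction (configs B e) (configs B e) (extend B e qs A)"
  using contraction_extend_family[of "{()}" B qs "\<lambda>_. A" e] assms
  by (simp only: contraction_stack_single)

section \<open>Contractivity of the elementary operations\<close>

lemma bounded_op_column:
  assumes A: "bounded_op X A" and y: "y \<in> X"
  shows "sq_summable X (\<lambda>x. A x y)"
proof -
  have sum1: "((\<lambda>x. f x * ket y x) has_sum f y) X" for f :: "'a \<Rightarrow> complex"
    by (rule has_sum_finite_neutralI[of "{y}"]) (use y in \<open>auto simp: ket_def\<close>)
  have "(\<lambda>x. (cmod (ket y x))\<^sup>2) summable_on X"
    by (rule finite_nonzero_values_imp_summable_on, rule finite_subset[of _ "{y}"])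
      (auto simp: ket_def)
  then have "ket y \<in> ell2 X" using y by (auto simp: ell2_def ket_def)
  then have "mat_apply X A (ket y) \<in> ell2 X" using A unfolding bounded_op_def by blast
  moreover have "mat_apply X A (ket y) = (\<lambda>x. A x y)"
    by (simp add: mat_apply_def infsumI[OF sum1])
  ultimately show ?thesis by (simp add: ell2_def sq_summable_def)
qed

text \<open>Boundedness makes the columns square summable, and entrywise completeness says that the
  stacked columns are orthonormal.\<close>

lemma contraction_measurement:
  assumes "measurement B M"
  shows "contraction (outcomes M \<times> configs B e) (configs B e) (\<lambda>(m, c). meas_op B e M m c)"
  unfolding meas_op_def
proof (rule contraction_extend_family, rule contraction_of_gram)
  let ?R = "reg_basis B (mreg M)"
  show "sq_summable ?R (\<lambda>r. mop M m r s)" if "m \<in> outcomes M" "s \<in> ?R" for m s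
    using assms that by (intro bounded_op_column) (auto simp: measurement_def)
  show "((\<lambda>m. \<Sum>\<^sub>\<infinity>r\<in>?R. cnj (mop M m r s) * mop M m r s') has_sum (if s = s' then 1 else 0)) (outcomes M)"
    if "s \<in> ?R" "s' \<in> ?R" for s s'
  proof -
    have "((\<lambda>m. mat_mult ?R (adjoint_mat (mop M m)) (mop M m) s s') has_sum id_mat ?R s s') (outcomes M)"
      using assms by (simp add: measurement_def)
    then show ?thesis using that by (simp add: mat_mult_def adjoint_mat_def id_mat_def)
  qed
qed

lemma contraction_unitary:
  assumes "unitary_op X U"
  shows "contraction X X U"
proof -
  have eq: "(\<Sum>\<^sub>\<infinity>r\<in>X. cnj (U r s) * U r s') = (if s = s' then 1 else 0)" if "s \<in> X" for s s'
  proof -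
    have "mat_mult X (adjoint_mat U) U s s' = id_mat X s s'"
      using assms by (simp add: unitary_op_def)
    then show ?thesis using that by (simp add: mat_mult_def adjoint_mat_def id_mat_def)
  qed
  have "contraction ({()} \<times> X) X (\<lambda>(_, r). U r)"
    by (rule contraction_of_gram)
      (use assms in \<open>auto simp: unitary_op_def eq intro!: bounded_op_column has_sum_finiteI\<close>)
  then show ?thesis by (simp only: contraction_stack_single)
qed

lemma contraction_id: "contraction X X (id_mat X)"
proof (rule contractionI)
  fix F G and v :: "'a \<Rightarrow> complex" assume *: "finite F" "F \<subseteq> X" "finite G" "G \<subseteq> X"
  have "(\<Sum>s\<in>G. id_mat X r s * v s) = (if r \<in> G then v r else 0)" if "r \<in> F" for r
  proof -
    have "(\<Sum>s\<in>G. id_mat X r s * v s) = (\<Sum>s\<in>G. if r = s then v s else 0)"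
      using that * by (intro sum.cong) (auto simp: id_mat_def)
    then show ?thesis using * by simp
  qed
  then have "(\<Sum>r\<in>F. (cmod (\<Sum>s\<in>G. id_mat X r s * v s))\<^sup>2) = (\<Sum>r\<in>F. if r \<in> G then (cmod (v r))\<^sup>2 else 0)"
    by (intro sum.cong) auto
  also have "\<dots> = (\<Sum>r\<in>F \<inter> G. (cmod (v r))\<^sup>2)"
    using * by (simp add: sum.inter_restrict)
  also have "\<dots> \<le> (\<Sum>s\<in>G. (cmod (v s))\<^sup>2)"
    using * by (intro sum_mono2) auto
  finally show "(\<Sum>r\<in>F. (cmod (\<Sum>s\<in>G. id_mat X r s * v s))\<^sup>2) \<le> (\<Sum>s\<in>G. (cmod (v s))\<^sup>2)" .
qed

lemma contraction_unit_vector: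
  assumes "sq_summable R \<psi>" "(\<Sum>\<^sub>\<infinity>r\<in>R. (cmod (\<psi> r))\<^sup>2) \<le> 1"
  shows "contraction R {s} (\<lambda>r _. \<psi> r)"
proof (rule contractionI)
  fix F G v assume *: "finite F" "F \<subseteq> R" "finite G" "G \<subseteq> {s}"
  have le: "(\<Sum>r\<in>F. (cmod (\<psi> r))\<^sup>2) \<le> 1"
    by (rule order_trans[OF finite_sum_le_infsum assms(2)]) (use assms * in \<open>auto simp: sq_summable_def\<close>)
  show "(\<Sum>r\<in>F. (cmod (\<Sum>s\<in>G. \<psi> r * v s))\<^sup>2) \<le> (\<Sum>s\<in>G. (cmod (v s))\<^sup>2)"
  proof (cases "G = {}")
    case False
    then have "G = {s}" using * by auto
    then show ?thesis
      using mult_right_mono[OF le, of "(cmod (v s))\<^sup>2"]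
      by (simp add: norm_mult power_mult_distrib sum_distrib_right)
  qed simp
qed

text \<open>Row \<open>(n, x)\<close> of the stacked operators
  \<open>|\<psi>\<rangle>\<langle>n|\<close> meets only column \<open>n\<close>, so the stack is
  block diagonal and every block is the unit vector \<psi> as a single column.\<close>

lemma contraction_init:
  fixes X :: "'a set"
  assumes "\<psi> \<in> ell2 X" "ell2_norm X \<psi> = 1"
  shows "contraction (X \<times> X) X (\<lambda>(n, x). ketbra \<psi> (ket n) x)"
proof (rule contraction_block[where f=fst and g=id])
  show "(case r of (n, x) \<Rightarrow> ketbra \<psi> (ket n) x) s = 0" if "fst r \<noteq> id s" for r :: "'a \<times> 'a" and s
    using that by (cases r) (simp add: ketbra_def ket_def)
  fix k :: 'a
  have "(\<Sum>\<^sub>\<infinity>x\<in>X. (cmod (\<psi> x))\<^sup>2) = 1"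
    using assms(2) by (simp add: ell2_norm_def real_sqrt_eq_1_iff)
  then have "contraction X {k} (\<lambda>x _. \<psi> x)"
    by (intro contraction_unit_vector) (use assms in \<open>auto simp: ell2_def sq_summable_def\<close>)
  then show "contraction {r \<in> X \<times> X. fst r = k} {s \<in> X. id s = k} (\<lambda>(n, x). ketbra \<psi> (ket n) x)"
    by (rule contraction_reindex[where f=snd and g=id]) (auto simp: inj_on_def ketbra_def ket_def)
qed

lemma contraction_diagonal:
  assumes "\<And>i. i \<in> I \<Longrightarrow> contraction R S (A i)"
  shows "contraction (I \<times> R) (I \<times> S) (\<lambda>(i, r) (j, s). if i = j then A i r s else 0)"
proof (rule contraction_block[where f=fst and g=fst])
  fix k
  show "contraction {r \<in> I \<times> R. fst r = k} {s \<in> I \<times> S. fst s = k}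
      (\<lambda>(i, r) (j, s). if i = j then A i r s else 0)"
  proof (cases "k \<in> I")
    case True
    show ?thesis
      by (rule contraction_reindex[OF assms[OF True], where f=snd and g=snd]) (auto simp: inj_on_def)
  next
    case False
    then have empty: "{r \<in> I \<times> R. fst r = k} = {}" by auto
    show ?thesis unfolding empty by (rule contractionI) (simp add: sum_nonneg)
  qed
qed auto

text \<open>Let \<open>\<Psi>\<close> have the columns \<open>\<psi>\<^sub>i\<close>. The stack of
  the \<open>|\<psi>\<^sub>i\<rangle>\<langle>\<psi>\<^sub>i|\<close> is the block diagonal
  arrangement of these columns times \<open>\<Psi>\<^sup>\<dagger>\<close>, and orthonormality makes
  both factors contractions.\<close>

lemma contraction_onb:
  assumes onb: "finite_onb X d \<psi>"
  shows "contraction ({..<d} \<times> X) X (\<lambda>(i, x). ketbra (\<psi> i) (\<psi> i) x)"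
proof -
  have "contraction ({()} \<times> X) {..<d} (\<lambda>(_, x) i. \<psi> i x)"
    by (rule contraction_of_gram[where A="\<lambda>_ x i. \<psi> i x"])
      (use onb in \<open>auto simp: finite_onb_def ell2_def sq_summable_def inner_prod_def
         intro!: has_sum_finiteI\<close>)
  then have \<Psi>: "contraction X {..<d} (\<lambda>x i. \<psi> i x)"
    using contraction_stack_single[of X "{..<d}" "\<lambda>x i. \<psi> i x"] by simp
  have "contraction ({..<d} \<times> X) {..<d} (\<lambda>(i, x) j. if i = j then \<psi> i x else 0)"
  proof (rule contraction_block[where f=fst and g=id])
    fix k
    show "contraction {r \<in> {..<d} \<times> X. fst r = k} {s \<in> {..<d}. id s = k}
        (\<lambda>(i, x) j. if i = j then \<psi> i x else 0)"
      by (rule contraction_reindex[OF \<Psi>, where f=snd and g=id]) (auto simp: inj_on_def)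
  qed auto
  from contraction_mult[OF this contraction_adjoint[OF \<Psi>]]
  show ?thesis
    by (rule iffD1[OF contraction_cong, rotated]) 
      (auto simp: ketbra_def if_distrib[of "\<lambda>a. a * _"] sum.delta cong: if_cong)
qed

section \<open>Associativity, commutation and products of extended operators\<close>

lemma mat_mult_assoc:
  assumes "contraction X X A" "contraction X X B" "contraction X X C" "x \<in> X" "z \<in> X"
  shows "mat_mult X (mat_mult X A B) C x z = mat_mult X A (mat_mult X B C) x z"
  unfolding mat_mult_def
  by (rule contraction_assoc[OF assms(2) contraction_column[OF assms(3,5)] contraction_row[OF assms(1,4)]])

lemma contraction_mat_mult:
  "contraction X X A \<Longrightarrow> contraction X X B \<Longrightarrow> contraction X X (mat_mult X A B)"
  unfolding mat_mult_def by (rule contraction_mult)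

lemma mat_mult_cong:
  assumes "\<And>x z. x \<in> X \<Longrightarrow> z \<in> X \<Longrightarrow> A x z = A' x z"
    and "\<And>z y. z \<in> X \<Longrightarrow> y \<in> X \<Longrightarrow> B z y = B' z y" and "x \<in> X" "y \<in> X"
  shows "mat_mult X A B x y = mat_mult X A' B' x y"
  unfolding mat_mult_def using assms by (intro infsum_cong) auto

definition commutes :: "'a set \<Rightarrow> 'a mat \<Rightarrow> 'a mat \<Rightarrow> bool" where
  "commutes X A B \<longleftrightarrow> (\<forall>x\<in>X. \<forall>y\<in>X. mat_mult X A B x y = mat_mult X B A x y)"

lemma commutesD: "commutes X A B \<Longrightarrow> x \<in> X \<Longrightarrow> y \<in> X \<Longrightarrow> mat_mult X A B x y = mat_mult X B A x y"
  by (simp add: commutes_def)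

lemma commutes_mat_mult:
  assumes K: "contraction X X K" and A: "contraction X X A" and B: "contraction X X B"
    and AK: "commutes X A K" and BK: "commutes X B K"
  shows "commutes X (mat_mult X A B) K"
  unfolding commutes_def
proof (intro ballI)
  fix x y assume xy: "x \<in> X" "y \<in> X"
  have "mat_mult X (mat_mult X A B) K x y = mat_mult X A (mat_mult X B K) x y"
    by (rule mat_mult_assoc[OF A B K xy])
  also have "\<dots> = mat_mult X A (mat_mult X K B) x y"
    by (rule mat_mult_cong[OF refl commutesD[OF BK] xy])
  also have "\<dots> = mat_mult X (mat_mult X A K) B x y"
    by (rule mat_mult_assoc[OF A K B xy, symmetric])
  also have "\<dots> = mat_mult X (mat_mult X K A) B x y"
    by (rule mat_mult_cong[OF commutesD[OF AK] refl xy])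
  also have "\<dots> = mat_mult X K (mat_mult X A B) x y"
    by (rule mat_mult_assoc[OF K A B xy])
  finally show "mat_mult X (mat_mult X A B) K x y = mat_mult X K (mat_mult X A B) x y" .
qed

lemma commutes_sum:
  assumes K: "contraction X X K" and A: "\<And>i. i \<in> I \<Longrightarrow> contraction X X (A i)"
    and AK: "\<And>i. i \<in> I \<Longrightarrow> commutes X (A i) K"
  shows "commutes X (\<lambda>x y. \<Sum>i\<in>I. A i x y) K"
  unfolding commutes_def
proof (intro ballI)
  fix x y assume xy: "x \<in> X" "y \<in> X"
  have "mat_mult X (\<lambda>x y. \<Sum>i\<in>I. A i x y) K x y = (\<Sum>i\<in>I. mat_mult X (A i) K x y)"
    unfolding mat_mult_def sum_distrib_right
    by (intro infsumI has_sum_sum has_sum_infsum sq_summable_mult contraction_row[OF A]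
        contraction_column[OF K] xy)
  also have "\<dots> = (\<Sum>i\<in>I. mat_mult X K (A i) x y)"
    by (intro sum.cong refl commutesD[OF AK] xy)
  also have "\<dots> = mat_mult X K (\<lambda>x y. \<Sum>i\<in>I. A i x y) x y"
    unfolding mat_mult_def sum_distrib_left
    by (intro infsumI[symmetric] has_sum_sum has_sum_infsum sq_summable_mult contraction_row[OF K]
        contraction_column[OF A] xy)
  finally show "mat_mult X (\<lambda>x y. \<Sum>i\<in>I. A i x y) K x y = mat_mult X K (\<lambda>x y. \<Sum>i\<in>I. A i x y) x y" .
qed

lemma commutes_id: "commutes X (id_mat X) A"
  unfolding commutes_def
proof (intro ballI)
  fix x y assume xy: "x \<in> X" "y \<in> X"
  have "mat_mult X (id_mat X) A x y = A x y"
    unfolding mat_mult_def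
    by (intro infsumI has_sum_finite_neutralI[of "{x}"]) (use xy in \<open>auto simp: id_mat_def\<close>)
  moreover have "mat_mult X A (id_mat X) x y = A x y"
    unfolding mat_mult_def
    by (intro infsumI has_sum_finite_neutralI[of "{y}"]) (use xy in \<open>auto simp: id_mat_def\<close>)
  ultimately show "mat_mult X (id_mat X) A x y = mat_mult X A (id_mat X) x y" by simp
qed

text \<open>At most one intermediate configuration contributes to the product: it takes its values
  from \<open>c'\<close> on \<open>qs\<close> and from \<open>c\<close> elsewhere. It is again a
  configuration, as it deviates from \<open>e\<close> at finitely many variables.\<close>

lemma mat_mult_extend_disjoint:
  assumes disj: "set qs \<inter> set rs = {}" and c: "c \<in> configs B e" "c' \<in> configs B e"
  shows "mat_mult (configs B e) (extend B e qs K) (extend B e rs L) c c' =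
    (if \<forall>q. q \<notin> set qs \<union> set rs \<longrightarrow> c q = c' q
     then K (map c qs) (map c' qs) * L (map c rs) (map c' rs) else 0)"
proof -
  define d where "d = (\<lambda>q. if q \<in> set qs then c' q else c q)"
  have "{q. d q \<noteq> e q} \<subseteq> {q. c q \<noteq> e q} \<union> {q. c' q \<noteq> e q}" by (auto simp: d_def)
  then have "finite {q. d q \<noteq> e q}"
    by (rule finite_subset) (use c in \<open>simp add: configs_def\<close>)
  then have dX: "d \<in> configs B e"
    using c by (simp add: configs_def) (simp add: d_def)
  have "mat_mult (configs B e) (extend B e qs K) (extend B e rs L) c c'
      = extend B e qs K c d * extend B e rs L d c'"
    unfolding mat_mult_def
  proof (rule infsumI, rule has_sum_finite_neutralI[of "{d}"])
    fix d' assume d': "d' \<in> configs B e - {d}"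
    show "extend B e qs K c d' * extend B e rs L d' c' = 0"
    proof (rule ccontr)
      assume "extend B e qs K c d' * extend B e rs L d' c' \<noteq> 0"
      then have "\<forall>q. q \<notin> set qs \<longrightarrow> c q = d' q" "\<forall>q. q \<notin> set rs \<longrightarrow> d' q = c' q"
        by (auto simp: extend_def split: if_splits)
      then have "d' = d" using disj by (auto simp: d_def fun_eq_iff)
      then show False using d' by simp
    qed
  qed (use dX in auto)
  moreover have "extend B e qs K c d = K (map c qs) (map c' qs)"
  proof -
    have map_d: "map d qs = map c' qs" by (simp add: d_def)
    have "c \<in> configs B e \<and> d \<in> configs B e \<and> (\<forall>q. q \<notin> set qs \<longrightarrow> c q = d q)"
      using c dX by (simp add: d_def)
    then show ?thesis unfolding extend_def map_d by (rule if_P)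
  qed
  moreover have "extend B e rs L d c' = (if \<forall>q. q \<notin> set qs \<union> set rs \<longrightarrow> c q = c' q
      then L (map c rs) (map c' rs) else 0)"
  proof -
    have "map d rs = map c rs" using disj by (auto simp: d_def)
    moreover have "(\<forall>q. q \<notin> set rs \<longrightarrow> d q = c' q) \<longleftrightarrow> (\<forall>q. q \<notin> set qs \<union> set rs \<longrightarrow> c q = c' q)"
      using disj by (auto simp: d_def)
    ultimately show ?thesis using c dX by (simp only: extend_def simp_thms)
  qed
  ultimately show ?thesis by (simp only: if_distrib[of "(*) _"] mult_zero_right)
qed

text \<open>The entry formula for disjoint registers is symmetric in the two operators.\<close>

lemma commutes_extend:
  assumes "set qs \<inter> set rs = {}"
  shows "commutes (configs B e) (extend B e qs K) (extend B e rs L)"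
proof -
  have "set rs \<inter> set qs = {}" using assms by auto
  then show ?thesis
    unfolding commutes_def
    by (intro ballI)
      (simp only: mat_mult_extend_disjoint assms Un_commute[of "set rs" "set qs"] mult.commute)
qed

text \<open>With the values off the register frozen to those of \<open>c\<close>, any basis tuple of
  the register can be written into \<open>c\<close>; distinctness of \<open>qs\<close> makes reading
  it back unambiguous. Only finitely many variables change, so the result stays in
  \<open>configs B e\<close>.\<close>

lemma bij_betw_map_configs:
  assumes qs: "distinct qs" and c: "c \<in> configs B e"
  shows "bij_betw (\<lambda>d. map d qs) {d \<in> configs B e. \<forall>q. q \<notin> set qs \<longrightarrow> c q = d q} (reg_basis B qs)"
proof (rule bij_betw_imageI)
  let ?D = "{d \<in> configs B e. \<forall>q. q \<notin> set qs \<longrightarrow> c q = d q}"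
  show "inj_on (\<lambda>d. map d qs) ?D"
    by (rule inj_on_map_configs) auto
  show "(\<lambda>d. map d qs) ` ?D = reg_basis B qs"
  proof (intro equalityI subsetI)
    fix xs assume xs: "xs \<in> reg_basis B qs"
    then have len: "length xs = length qs" by (auto simp: reg_basis_def list_all2_lengthD)
    define d where "d q = (case map_of (zip qs xs) q of Some b \<Rightarrow> b | None \<Rightarrow> c q)" for q
    have nth: "d (qs ! i) = xs ! i" if "i < length qs" for i
      using that len qs by (simp add: d_def map_of_zip_nth)
    have off: "d q = c q" if "q \<notin> set qs" for q
    proof -
      have "map_of (zip qs xs) q = None" using that len by (simp add: map_of_zip_is_None)
      then show ?thesis by (simp add: d_def)
    qed
    have dB: "d q \<in> B q" for q
    proof (cases "q \<in> set qs")
      case True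
      then obtain i where "i < length qs" "q = qs ! i" by (auto simp: in_set_conv_nth)
      then show ?thesis using nth xs by (auto simp: reg_basis_def list_all2_conv_all_nth)
    qed (use off c in \<open>auto simp: configs_def\<close>)
    have "{q. d q \<noteq> e q} \<subseteq> {q. c q \<noteq> e q} \<union> set qs" using off by auto
    then have "finite {q. d q \<noteq> e q}"
      by (rule finite_subset) (use c in \<open>simp add: configs_def\<close>)
    then have "d \<in> ?D" using dB off by (auto simp: configs_def)
    moreover have "map d qs = xs" using nth len by (auto intro: nth_equalityI)
    ultimately show "xs \<in> (\<lambda>d. map d qs) ` ?D" by blast
  qed (auto intro: map_configs_reg_basis)
qed

lemma mat_mult_extend:
  assumes qs: "distinct qs" and c: "c \<in> configs B e" "c' \<in> configs B e"
  shows "mat_mult (configs B e) (extend B e qs K) (extend B e qs L) c c'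
    = extend B e qs (mat_mult (reg_basis B qs) K L) c c'"
proof (cases "\<forall>q. q \<notin> set qs \<longrightarrow> c q = c' q")
  case True
  let ?D = "{d \<in> configs B e. \<forall>q. q \<notin> set qs \<longrightarrow> c q = d q}"
  have "mat_mult (configs B e) (extend B e qs K) (extend B e qs L) c c'
      = (\<Sum>\<^sub>\<infinity>d\<in>?D. K (map c qs) (map d qs) * L (map d qs) (map c' qs))"
    unfolding mat_mult_def
    by (rule infsum_cong_neutral) (use True c in \<open>auto simp: extend_def\<close>)
  also have "\<dots> = mat_mult (reg_basis B qs) K L (map c qs) (map c' qs)"
    unfolding mat_mult_def by (rule infsum_reindex_bij_betw[OF bij_betw_map_configs[OF qs c(1)]])
  finally show ?thesis using True c by (simp add: extend_def)
next
  case False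
  have "extend B e qs K c d * extend B e qs L d c' = 0" for d
    using False by (auto simp: extend_def)
  then have "mat_mult (configs B e) (extend B e qs K) (extend B e qs L) c c' = 0"
    unfolding mat_mult_def by (intro infsum_0) blast
  moreover have "extend B e qs (mat_mult (reg_basis B qs) K L) c c' = 0"
    using False by (auto simp: extend_def)
  ultimately show ?thesis by simp
qed

lemma extend_onb_idem:
  assumes qs: "distinct qs" and onb: "finite_onb (reg_basis B qs) d \<psi>" and i: "i < d"
    and c: "c \<in> configs B e" "c' \<in> configs B e"
  shows "mat_mult (configs B e) (extend B e qs (ketbra (\<psi> i) (\<psi> i))) (extend B e qs (ketbra (\<psi> i) (\<psi> i))) c c'
    = extend B e qs (ketbra (\<psi> i) (\<psi> i)) c c'"
proof -
  have "mat_mult (reg_basis B qs) (ketbra (\<psi> i) (\<psi> i)) (ketbra (\<psi> i) (\<psi> i)) x y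
      = \<psi> i x * cnj (\<psi> i y) * inner_prod (reg_basis B qs) (\<psi> i) (\<psi> i)" for x y
    by (simp add: mat_mult_def ketbra_def inner_prod_def infsum_cmult_right'[symmetric] mult_ac
        del: infsum_cmult_right')
  then have "mat_mult (reg_basis B qs) (ketbra (\<psi> i) (\<psi> i)) (ketbra (\<psi> i) (\<psi> i)) = ketbra (\<psi> i) (\<psi> i)"
    using onb i by (intro ext) (simp add: finite_onb_def ketbra_def)
  then show ?thesis using mat_mult_extend[OF qs c] by simp
qed

text \<open>With \<open>P\<^sub>i = |\<psi>\<^sub>i\<rangle>\<langle>\<psi>\<^sub>i|\<close>, idempotence and commutation give
  \<open>\<Sum>\<^sub>i P\<^sub>i C\<^sub>i = \<Sum>\<^sub>i P\<^sub>i C\<^sub>i P\<^sub>i\<close>, a product of the row of the \<open>P\<^sub>i\<close>, the diagonal of the \<open>C\<^sub>i\<close>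
  and the column of the \<open>P\<^sub>i\<close>.\<close>

lemma contraction_qif:
  fixes d :: nat
  assumes P: "contraction ({..<d} \<times> X) X (\<lambda>(i, x). P i x)"
    and herm: "\<And>i x y. i < d \<Longrightarrow> cnj (P i y x) = P i x y"
    and idem: "\<And>i x y. i < d \<Longrightarrow> x \<in> X \<Longrightarrow> y \<in> X \<Longrightarrow> mat_mult X (P i) (P i) x y = P i x y"
    and C: "\<And>i. i < d \<Longrightarrow> contraction X X (C i)"
    and comm: "\<And>i. i < d \<Longrightarrow> commutes X (C i) (P i)"
  shows "contraction X X (\<lambda>x y. \<Sum>i<d. mat_mult X (P i) (C i) x y)"
proof -
  let ?I = "{..<d} \<times> X"
  have Pi: "contraction X X (P i)" if "i < d" for i
    using contraction_stack_member[OF P] that by simp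
  define D where "D = (\<lambda>(i, x) (j, y). if i = j then C i x y else 0)"
  have D: "contraction ?I ?I D"
    unfolding D_def by (rule contraction_diagonal) (use C in auto)
  define E where "E r z = (\<Sum>\<^sub>\<infinity>s\<in>?I. D r s * (case s of (i, x) \<Rightarrow> P i x) z)" for r z
  have E: "contraction ?I X E"
    unfolding E_def by (rule contraction_mult[OF D P])
  have E_eq: "E (i, x) z = mat_mult X (C i) (P i) x z" if "i < d" for i x z
  proof -
    \<comment> \<open>\<open>D\<close> vanishes off the diagonal blocks, so only the
      \<open>i\<close>-th copy of \<open>X\<close> contributes to the sum over pairs.\<close>
    have "E (i, x) z = (\<Sum>\<^sub>\<infinity>s\<in>Pair i ` X. D (i, x) s * (case s of (i, x) \<Rightarrow> P i x) z)"
      unfolding E_def using that by (intro infsum_cong_neutral) (auto simp: D_def)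
    also have "\<dots> = mat_mult X (C i) (P i) x z"
      by (subst infsum_reindex) (auto simp: inj_on_def mat_mult_def D_def o_def)
    finally show ?thesis .
  qed
  define R where "R = (\<lambda>x (i, y). cnj (P i y x))"
  have R: "contraction X ?I R"
    using contraction_adjoint[OF P] by (simp add: R_def case_prod_unfold)
  have "(\<Sum>\<^sub>\<infinity>r\<in>?I. R x r * E r z) = (\<Sum>i<d. mat_mult X (P i) (C i) x z)" if xz: "x \<in> X" "z \<in> X" for x z
  proof -
    have "(\<lambda>r. R x r * E r z) summable_on ?I"
      by (intro sq_summable_mult contraction_row[OF R] contraction_column[OF E] xz)
    then have "(\<Sum>\<^sub>\<infinity>r\<in>?I. R x r * E r z) = (\<Sum>\<^sub>\<infinity>i\<in>{..<d}. \<Sum>\<^sub>\<infinity>y\<in>X. R x (i, y) * E (i, y) z)"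
      by (rule infsum_Sigma_banach[symmetric])
    also have "\<dots> = (\<Sum>i<d. mat_mult X (P i) (mat_mult X (C i) (P i)) x z)"
      unfolding infsum_finite[OF finite_lessThan] R_def prod.case mat_mult_def[of X _ "mat_mult X _ _"]
      by (intro sum.cong refl infsum_cong) (simp add: E_eq herm)
    also have "\<dots> = (\<Sum>i<d. mat_mult X (P i) (C i) x z)"
    proof (intro sum.cong refl)
      fix i assume "i \<in> {..<d}"
      then have i: "i < d" by simp
      have "mat_mult X (P i) (mat_mult X (C i) (P i)) x z = mat_mult X (P i) (mat_mult X (P i) (C i)) x z"
        by (rule mat_mult_cong[OF refl commutesD[OF comm[OF i]] xz])
      also have "\<dots> = mat_mult X (mat_mult X (P i) (P i)) (C i) x z"
        by (rule mat_mult_assoc[OF Pi[OF i] Pi[OF i] C[OF i] xz, symmetric])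
      also have "\<dots> = mat_mult X (P i) (C i) x z"
        by (rule mat_mult_cong[OF idem[OF i] refl xz])
      finally show "mat_mult X (P i) (mat_mult X (C i) (P i)) x z = mat_mult X (P i) (C i) x z" .
    qed
    finally show ?thesis .
  qed
  then show ?thesis
    using contraction_mult[OF R E] contraction_cong[of X X "\<lambda>x z. \<Sum>\<^sub>\<infinity>r\<in>?I. R x r * E r z"] by simp
qed

text \<open>Both claims need one joint induction: a quantum conditional is a contraction because its
  branches commute with the control projections, and commutation is inherited through associativity,
  which rests on contractivity. Commutation is stated for all contractions on registers disjoint
  from the circuit, so that the projections of an enclosing conditional are covered.\<close>

lemma circ_sem_contraction_commutes:
  assumes "wf_circ B G C"
  shows "contraction (configs B e) (configs B e) (circ_sem B e C) \<and>
    (\<forall>qs K. set qs \<inter> circ_vars C = {} \<longrightarrow> contraction (reg_basis B qs) (reg_basis B qs) K \<longrightarrow>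
       commutes (configs B e) (circ_sem B e C) (extend B e qs K))"
  using assms
proof (induction C)
  case CSkip
  then show ?case by (simp add: contraction_id commutes_id)
next
  case (CGate U rs)
  have "contraction (configs B e) (configs B e) (extend B e rs U)"
    by (rule contraction_extend, rule contraction_unitary) (use CGate in simp)
  moreover have "commutes (configs B e) (extend B e rs U) (extend B e qs K)"
    if "set qs \<inter> set rs = {}" for qs K
    by (rule commutes_extend) (use that in auto)
  ultimately show ?case by simp
next
  case (CSeq C D)
  let ?X = "configs B e"
  have C: "contraction ?X ?X (circ_sem B e C)" and D: "contraction ?X ?X (circ_sem B e D)"
    using CSeq by auto
  have "commutes ?X (mat_mult ?X (circ_sem B e D) (circ_sem B e C)) (extend B e qs K)"
    if "set qs \<inter> (circ_vars C \<union> circ_vars D) = {}" "contraction (reg_basis B qs) (reg_basis B qs) K"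
    for qs K
  proof (rule commutes_mat_mult[OF contraction_extend[OF that(2)] D C])
    show "commutes ?X (circ_sem B e D) (extend B e qs K)" "commutes ?X (circ_sem B e C) (extend B e qs K)"
      using CSeq that by auto
  qed
  with contraction_mat_mult[OF D C] show ?case by simp
next
  case (CQif rs d \<psi> C)
  let ?X = "configs B e"
  let ?P = "\<lambda>i. extend B e rs (ketbra (\<psi> i) (\<psi> i))"
  have wf: "distinct rs" "finite_onb (reg_basis B rs) d \<psi>"
    "\<And>i. i < d \<Longrightarrow> wf_circ B G (C i)" "\<And>i. i < d \<Longrightarrow> set rs \<inter> circ_vars (C i) = {}"
    using CQif.prems by auto
  have C: "contraction ?X ?X (circ_sem B e (C i))"
    and comm: "set qs \<inter> circ_vars (C i) = {} \<Longrightarrow> contraction (reg_basis B qs) (reg_basis B qs) K \<Longrightarrow>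
       commutes ?X (circ_sem B e (C i)) (extend B e qs K)" if "i < d" for i qs K
    using CQif.IH[OF rangeI wf(3)[OF that]] by blast+
  note onb = contraction_onb[OF wf(2)]
  have P: "contraction ?X ?X (?P i)" if "i < d" for i
    by (intro contraction_extend contraction_stack_member[OF onb]) (use that in simp)
  have "contraction ?X ?X (circ_sem B e (CQif rs d \<psi> C))"
    unfolding circ_sem.simps
  proof (rule contraction_qif)
    show "contraction ({..<d} \<times> ?X) ?X (\<lambda>(i, x). ?P i x)"
      by (rule contraction_extend_family[OF onb])
    show "cnj (?P i y x) = ?P i x y" for i x y
      by (auto simp: extend_def ketbra_def)
    show "commutes ?X (circ_sem B e (C i)) (?P i)" if "i < d" for i
      by (rule comm[OF that wf(4)[OF that]], rule contraction_stack_member[OF onb]) (use that in simp)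
  qed (use C extend_onb_idem[OF wf(1,2)] in auto)
  moreover have "commutes ?X (circ_sem B e (CQif rs d \<psi> C)) (extend B e qs K)"
    if qs: "set qs \<inter> circ_vars (CQif rs d \<psi> C) = {}" and K: "contraction (reg_basis B qs) (reg_basis B qs) K"
    for qs K
    unfolding circ_sem.simps
  proof (rule commutes_sum)
    fix i assume "i \<in> {..<d}"
    then have i: "i < d" by simp
    have disj: "set rs \<inter> set qs = {}" "set qs \<inter> circ_vars (C i) = {}" using qs i by auto
    show "contraction ?X ?X (mat_mult ?X (?P i) (circ_sem B e (C i)))"
      by (rule contraction_mat_mult[OF P[OF i] C[OF i]])
    show "commutes ?X (mat_mult ?X (?P i) (circ_sem B e (C i))) (extend B e qs K)"
      by (rule commutes_mat_mult[OF contraction_extend[OF K] P[OF i] C[OF i] commutes_extend[OF disj(1)]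
            comm[OF i disj(2) K]])
  qed (rule contraction_extend[OF K])
  ultimately show ?case by blast
qed

section \<open>Programs\<close>

text \<open>Finitely supported vectors lie in \<open>\<ell>\<^sup>2(X)\<close>, and on them the
  infinite sums in the definition of positivity become finite forms.\<close>

lemma partial_density_positive_trace_class:
  assumes "\<rho> \<in> partial_density X"
  shows "positive_trace_class X \<rho>"
  unfolding positive_trace_class_def
proof
  show "(\<lambda>x. Re (\<rho> x x)) summable_on X"
    using assms by (auto simp: partial_density_def intro: summable_on_Re)
  show "psd X \<rho>"
  proof (rule psdI)
    fix F and v :: "'a \<Rightarrow> complex" assume F: "finite F" "F \<subseteq> X"
    define w where "w x = (if x \<in> F then v x else 0)" for x
    have "(\<lambda>x. (cmod (w x))\<^sup>2) summable_on X"
      by (rule finite_nonzero_values_imp_summable_on, rule finite_subset[OF _ F(1)]) (auto simp: w_def)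
    then have "w \<in> ell2 X" using F by (auto simp: ell2_def w_def)
    then have "inner_prod X w (mat_apply X \<rho> w) \<in> \<real>\<^sub>\<ge>\<^sub>0"
      using assms by (simp add: partial_density_def positive_op_def)
    also have "mat_apply X \<rho> w = (\<lambda>x. \<Sum>y\<in>F. \<rho> x y * v y)"
      unfolding mat_apply_def
      by (intro ext infsumI has_sum_finite_neutralI[OF F]) (auto simp: w_def)
    also have "inner_prod X w (\<lambda>x. \<Sum>y\<in>F. \<rho> x y * v y) = (\<Sum>x\<in>F. \<Sum>y\<in>F. cnj (v x) * \<rho> x y * v y)"
      unfolding inner_prod_def
      by (intro infsumI has_sum_finite_neutralI[OF F]) (auto simp: w_def sum_distrib_left mult.assoc)
    finally show "(\<Sum>x\<in>F. \<Sum>y\<in>F. cnj (v x) * \<rho> x y * v y) \<in> \<real>\<^sub>\<ge>\<^sub>0" .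
  qed
qed

text \<open>Common core of initialisation and branching: the branches share the trace of \<rho>
  among them, and no continuation \<open>F m\<close> gains trace.\<close>

lemma infsum_kraus_positive_trace_class:
  assumes A: "contraction (I \<times> X) X (\<lambda>(m, x). A m x)" and \<rho>: "positive_trace_class X \<rho>"
    and F: "\<And>m \<sigma>. m \<in> I \<Longrightarrow> positive_trace_class X \<sigma> \<Longrightarrow>
      positive_trace_class X (F m \<sigma>) \<and> trace X (F m \<sigma>) \<le> trace X \<sigma>"
  shows "positive_trace_class X (\<lambda>x y. \<Sum>\<^sub>\<infinity>m\<in>I. F m (conj_by X (A m) \<rho>) x y) \<and>
    trace X (\<lambda>x y. \<Sum>\<^sub>\<infinity>m\<in>I. F m (conj_by X (A m) \<rho>) x y) \<le> trace X \<rho>"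
proof -
  note K = kraus_positive_trace_class[OF A \<rho>]
  have pos: "positive_trace_class X (F m (conj_by X (A m) \<rho>))"
    and le: "trace X (F m (conj_by X (A m) \<rho>)) \<le> trace X (conj_by X (A m) \<rho>)" if "m \<in> I" for m
    using F[OF that K(1)[OF that]] by auto
  have sm: "(\<lambda>m. trace X (F m (conj_by X (A m) \<rho>))) summable_on I"
    by (rule summable_on_comparison_test[OF K(2) le trace_nonneg[OF pos]])
  note S = infsum_positive_trace_class[OF pos sm]
  have "trace X (\<lambda>x y. \<Sum>\<^sub>\<infinity>m\<in>I. F m (conj_by X (A m) \<rho>) x y)
      \<le> (\<Sum>\<^sub>\<infinity>m\<in>I. trace X (F m (conj_by X (A m) \<rho>)))"
    by (rule S(3))
  also have "\<dots> \<le> (\<Sum>\<^sub>\<infinity>m\<in>I. trace X (conj_by X (A m) \<rho>))"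
    by (rule infsum_mono[OF sm K(2) le])
  also have "\<dots> \<le> trace X \<rho>" by (rule K(3))
  finally show ?thesis using S(2) by blast
qed

text \<open>\<open>r n\<close> is the state before the test number \<open>n\<close>, counted from 0.
  The test splits its trace into a part that leaves the loop and a part that enters the body, and
  the body gains nothing; telescoping bounds the total trace that leaves.\<close>

lemma loop_positive_trace_class:
  fixes A :: "nat \<Rightarrow> 'a mat"
  assumes A: "contraction ({0, 1} \<times> X) X (\<lambda>(m, x). A m x)" and \<rho>: "positive_trace_class X \<rho>"
    and F: "\<And>\<sigma>. positive_trace_class X \<sigma> \<Longrightarrow>
      positive_trace_class X (F \<sigma>) \<and> trace X (F \<sigma>) \<le> trace X \<sigma>"
  defines "r n \<equiv> ((F \<circ> conj_by X (A 1)) ^^ n) \<rho>"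
  shows "positive_trace_class X (r n)"
    and "positive_trace_class X (conj_by X (A 0) (r n))"
    and "(\<lambda>n. trace X (conj_by X (A 0) (r n))) summable_on UNIV"
    and "(\<Sum>\<^sub>\<infinity>n\<in>UNIV. trace X (conj_by X (A 0) (r n))) \<le> trace X \<rho>"
proof -
  note K = kraus_positive_trace_class[OF A]
  have r_Suc: "r (Suc n) = F (conj_by X (A 1) (r n))" for n by (simp add: r_def)
  show pos: "positive_trace_class X (r n)" for n
    by (induction n) (simp_all add: r_Suc F K(1) \<rho>, simp add: r_def \<rho>)
  show pos0: "positive_trace_class X (conj_by X (A 0) (r n))" for n
    by (rule K(1)[OF pos]) simp
  have step: "trace X (conj_by X (A 0) (r n)) + trace X (r (Suc n)) \<le> trace X (r n)" for n
  proof -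
    have "trace X (r (Suc n)) \<le> trace X (conj_by X (A 1) (r n))"
      unfolding r_Suc using F[OF K(1)[OF pos]] by blast
    then show ?thesis using K(3)[OF pos, of n] by simp
  qed
  \<comment> \<open>The trace still inside the loop after \<open>N\<close> rounds must stay on the
    left for the induction; being nonnegative, it is dropped afterwards.\<close>
  have partial: "(\<Sum>n<N. trace X (conj_by X (A 0) (r n))) + trace X (r N) \<le> trace X \<rho>" for N
  proof (induction N)
    case (Suc N)
    then show ?case using step[of N] by simp
  qed (simp add: r_def)
  have fin: "(\<Sum>n\<in>M. trace X (conj_by X (A 0) (r n))) \<le> trace X \<rho>" if "finite M" for M
  proof -
    obtain N where "M \<subseteq> {..<N}" using \<open>finite M\<close> finite_nat_iff_bounded by auto
    then have "(\<Sum>n\<in>M. trace X (conj_by X (A 0) (r n))) \<le> (\<Sum>n<N. trace X (conj_by X (A 0) (r n)))"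
      by (intro sum_mono2 trace_nonneg[OF pos0]) auto
    then show ?thesis using partial[of N] trace_nonneg[OF pos[of N]] by linarith
  qed
  show "(\<lambda>n. trace X (conj_by X (A 0) (r n))) summable_on UNIV"
    by (rule nonneg_bdd_above_summable_on) (auto intro!: trace_nonneg[OF pos0] bdd_aboveI2 fin)
  then show "(\<Sum>\<^sub>\<infinity>n\<in>UNIV. trace X (conj_by X (A 0) (r n))) \<le> trace X \<rho>"
    by (rule infsum_le_finite_sums) (rule fin)
qed

lemma prog_sem_While:
  "prog_sem B e (While M P) \<rho> = (\<lambda>c c'. \<Sum>\<^sub>\<infinity>n\<in>UNIV. conj_by (configs B e) (meas_op B e M 0)
    (((prog_sem B e P \<circ> conj_by (configs B e) (meas_op B e M 1)) ^^ n) \<rho>) c c')"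
  by simp

lemma contraction_binary_measurement:
  assumes "binary_measurement B M"
  shows "contraction ({0, 1} \<times> configs B e) (configs B e) (\<lambda>(m, c). meas_op B e M m c)"
  using assms contraction_measurement[of B M e] by (simp add: binary_measurement_def)

text \<open>The induction ranges over all inputs, because the second program of a sequence and the
  body of a loop start from intermediate states.\<close>

lemma prog_sem_positive_trace_class:
  assumes "wf_prog B G P" "positive_trace_class (configs B e) \<rho>"
  shows "positive_trace_class (configs B e) (prog_sem B e P \<rho>) \<and>
    trace (configs B e) (prog_sem B e P \<rho>) \<le> trace (configs B e) \<rho>"
  using assms
proof (induction P arbitrary: \<rho>)
  case Skip
  then show ?case by simp
next
  case Abort
  then show ?case
    by (simp add: positive_trace_class_def psd_def trace_def infsum_nonneg psd_diag(1)
        trace_nonneg[unfolded trace_def])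
next
  case (Init qs \<psi>)
  then show ?case
    \<comment> \<open>The Kraus operators are the extensions of
      \<open>|\<psi>\<rangle>\<langle>n|\<close>; nothing follows them, so the continuation is the
      identity.\<close>
    using infsum_kraus_positive_trace_class[OF contraction_extend_family[OF contraction_init], of \<psi> B qs e \<rho> "\<lambda>_ \<sigma>. \<sigma>"]
    by simp
next
  case (Circ C)
  then show ?case
    using conj_by_positive_trace_class[of "configs B e" "circ_sem B e C" \<rho>]
      circ_sem_contraction_commutes[of B G C e] by simp
next
  case (Seq P Q)
  have "positive_trace_class (configs B e) (prog_sem B e P \<rho>)"
    "trace (configs B e) (prog_sem B e P \<rho>) \<le> trace (configs B e) \<rho>"
    using Seq.IH(1)[of \<rho>] Seq.prems by simp_all
  then show ?case
    using Seq.IH(2)[of "prog_sem B e P \<rho>"] Seq.prems by simp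
next
  case (If M P)
  then show ?case
    using infsum_kraus_positive_trace_class[OF contraction_measurement, of B M e \<rho> "\<lambda>m. prog_sem B e (P m)"]
    by simp
next
  case (While M P)
  have wf: "binary_measurement B M" "wf_prog B G P" using While.prems by auto
  note L = loop_positive_trace_class[OF contraction_binary_measurement[OF wf(1)] While.prems(2)
      While.IH[OF wf(2)]]
  note S = infsum_positive_trace_class[of UNIV, OF L(2,3)]
  show ?case
    unfolding prog_sem_While using S(2) order_trans[OF S(3) L(4)] by blast
qed

text \<open>Programs are compared as functions on all pairs of indices, whereas positivity and trace
  see only entries over \<open>X\<close>; this settles the remaining entries.\<close>

lemma conj_by_outside:
  assumes "\<And>x y. x \<notin> X \<or> y \<notin> X \<Longrightarrow> A x y = 0" "x \<notin> X \<or> y \<notin> X"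
  shows "conj_by X A \<rho> x y = 0"
  using assms(2)
proof
  assume "x \<notin> X"
  then have "A x z = 0" for z using assms(1) by simp
  then show ?thesis by (simp add: conj_by_def mat_mult_def)
next
  assume "y \<notin> X"
  then have "A y z = 0" for z using assms(1) by simp
  then show ?thesis by (simp add: conj_by_def mat_mult_def adjoint_mat_def)
qed

lemma conj_by_zero: "conj_by X A (\<lambda>_ _. 0) = (\<lambda>_ _. 0)"
  by (simp add: conj_by_def mat_mult_def)

text \<open>Once a branch has probability 0, everything executed in it contributes nothing.\<close>

lemma prog_sem_zero: "prog_sem B e P (\<lambda>_ _. 0) = (\<lambda>_ _. 0)"
proof (induction P)
  case (While M P)
  have "((prog_sem B e P \<circ> conj_by (configs B e) (meas_op B e M 1)) ^^ n) (\<lambda>_ _. 0) = (\<lambda>_ _. 0)" for n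
    by (induction n) (simp_all add: conj_by_zero While)
  then show ?case unfolding prog_sem_While by (simp add: conj_by_zero)
qed (simp_all add: conj_by_zero)

lemma infsum_nat_shift:
  fixes f :: "nat \<Rightarrow> complex"
  assumes "f summable_on UNIV"
  shows "infsum f UNIV = f 0 + (\<Sum>\<^sub>\<infinity>n\<in>UNIV. f (Suc n))"
proof -
  have "infsum f UNIV = infsum f (insert 0 (range Suc))"
    by (simp add: UNIV_nat_eq[symmetric])
  also have "\<dots> = f 0 + infsum f (range Suc)"
    by (rule infsum_insert) (auto intro: summable_on_subset[OF assms])
  also have "infsum f (range Suc) = (\<Sum>\<^sub>\<infinity>n\<in>UNIV. f (Suc n))"
    by (subst infsum_reindex) (auto simp: o_def)
  finally show ?thesis .
qed

lemma meas_op_outside: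
  "c \<notin> configs B e \<or> c' \<notin> configs B e \<Longrightarrow> meas_op B e M m c c' = 0"
  unfolding meas_op_def by (rule extend_outside)

lemma conj_by_meas_op_outside:
  "c \<notin> configs B e \<or> c' \<notin> configs B e \<Longrightarrow> conj_by (configs B e) (meas_op B e M m) \<rho> c c' = 0"
  by (rule conj_by_outside[OF meas_op_outside])

text \<open>The term \<open>n = 0\<close> is split off, and in the others one round is moved from
  the iterate onto the initial state. Splitting requires the entries to be summable, which the trace
  bound of the loop provides. The input is any positive trace class matrix, so that post-measurement
  states are covered.\<close>

lemma prog_sem_While_unfold:
  assumes wf: "binary_measurement B M" "wf_prog B G P" and \<rho>: "positive_trace_class (configs B e) \<rho>"
  shows "prog_sem B e (While M P) \<rho> = (\<lambda>c c'. conj_by (configs B e) (meas_op B e M 0) \<rho> c c' +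
    prog_sem B e (While M P) (prog_sem B e P (conj_by (configs B e) (meas_op B e M 1) \<rho>)) c c')"
proof (intro ext)
  fix c c'
  let ?E = "\<lambda>m. conj_by (configs B e) (meas_op B e M m)"
  note L = loop_positive_trace_class[OF contraction_binary_measurement[OF wf(1)] \<rho>
      prog_sem_positive_trace_class[OF wf(2)]]
  have "(\<lambda>n. ?E 0 (((prog_sem B e P \<circ> ?E 1) ^^ n) \<rho>) c c') summable_on UNIV"
  proof (cases "c \<in> configs B e \<and> c' \<in> configs B e")
    case True
    then show ?thesis by (intro infsum_positive_trace_class(1)[OF L(2,3)]) auto
  next
    case False
    then show ?thesis by (simp add: conj_by_meas_op_outside)
  qed
  from infsum_nat_shift[OF this]
  show "prog_sem B e (While M P) \<rho> c c' = ?E 0 \<rho> c c' +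
      prog_sem B e (While M P) (prog_sem B e P (?E 1 \<rho>)) c c'"
    unfolding prog_sem_While by (simp add: funpow_swap1)
qed

lemma prog_sem_cond:
  assumes "binary_measurement B N"
  shows "prog_sem B e (P\<^sub>0 \<triangleleft> N \<triangleright> P\<^sub>1) \<rho> = (\<lambda>c c'.
    prog_sem B e P\<^sub>0 (conj_by (configs B e) (meas_op B e N 0) \<rho>) c c' +
    prog_sem B e P\<^sub>1 (conj_by (configs B e) (meas_op B e N 1) \<rho>) c c')"
  using assms by (simp add: cond_def binary_measurement_def)

section \<open>States fixed by a measurement outcome\<close>

lemma conj_by_meas_op_fixed:
  assumes \<sigma>: "positive_trace_class (configs B e) \<sigma>" and \<alpha>: "cmod \<alpha> = 1"
    and eig: "\<And>x y. x \<in> configs B e \<Longrightarrow> y \<in> configs B e \<Longrightarrow>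
      (\<Sum>\<^sub>\<infinity>u\<in>configs B e. meas_op B e N m x u * \<sigma> u y) = \<alpha> * \<sigma> x y"
    and outside: "\<And>x y. x \<notin> configs B e \<or> y \<notin> configs B e \<Longrightarrow> \<sigma> x y = 0"
  shows "conj_by (configs B e) (meas_op B e N m) \<sigma> = \<sigma>"
proof (intro ext)
  fix x y
  show "conj_by (configs B e) (meas_op B e N m) \<sigma> x y = \<sigma> x y"
  proof (cases "x \<in> configs B e \<and> y \<in> configs B e")
    case True
    then show ?thesis using conj_by_fixed[OF positive_trace_class_psd[OF \<sigma>] \<alpha> eig] by blast
  next
    case False
    then have out: "x \<notin> configs B e \<or> y \<notin> configs B e" by blast
    show ?thesis using conj_by_meas_op_outside[OF out] outside[OF out] by simp
  qed
qed

lemma conj_by_meas_op_eq_0: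
  assumes N: "binary_measurement B N" and \<sigma>: "positive_trace_class (configs B e) \<sigma>"
    and m: "m \<in> {0, 1}" "m' \<in> {0, 1}" "m \<noteq> m'"
    and fixed: "conj_by (configs B e) (meas_op B e N m) \<sigma> = \<sigma>"
  shows "conj_by (configs B e) (meas_op B e N m') \<sigma> = (\<lambda>_ _. 0)"
proof (intro ext)
  fix x y
  show "conj_by (configs B e) (meas_op B e N m') \<sigma> x y = 0"
  proof (cases "x \<in> configs B e \<and> y \<in> configs B e")
    case True
    then show ?thesis
      using conj_by_eq_0[OF contraction_binary_measurement[OF N] \<sigma> m] fixed by simp
  next
    case False
    then show ?thesis by (intro conj_by_meas_op_outside) blast
  qed
qed

text \<open>The operator relation \<open>M\<^sub>m N\<^sub>n = \<alpha> N\<^sub>n\<close> in terms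
  of states: after outcome \<open>n\<close> of \<open>N\<close>, outcome \<open>m\<close> of
  \<open>M\<close> changes nothing.\<close>

lemma conj_by_meas_op_conj_by:
  assumes M: "binary_measurement B M" "m \<in> {0, 1}" and N: "binary_measurement B N" "n \<in> {0, 1}"
    and \<rho>: "positive_trace_class (configs B e) \<rho>" and \<alpha>: "cmod \<alpha> = 1"
    and eig: "mat_mult (configs B e) (meas_op B e M m) (meas_op B e N n) = (\<lambda>c c'. \<alpha> * meas_op B e N n c c')"
  shows "conj_by (configs B e) (meas_op B e M m) (conj_by (configs B e) (meas_op B e N n) \<rho>)
    = conj_by (configs B e) (meas_op B e N n) \<rho>"
proof -
  have CM: "contraction (configs B e) (configs B e) (meas_op B e M m)"
    and CN: "contraction (configs B e) (configs B e) (meas_op B e N n)"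
    using contraction_stack_member[OF contraction_binary_measurement[OF M(1)] M(2)]
      contraction_stack_member[OF contraction_binary_measurement[OF N(1)] N(2)] by auto
  show ?thesis
  proof (rule conj_by_meas_op_fixed[OF conj_by_positive_trace_class(1)[OF CN \<rho>] \<alpha>])
    show "(\<Sum>\<^sub>\<infinity>u\<in>configs B e. meas_op B e M m x u * conj_by (configs B e) (meas_op B e N n) \<rho> u y)
        = \<alpha> * conj_by (configs B e) (meas_op B e N n) \<rho> x y"
      if "x \<in> configs B e" "y \<in> configs B e" for x y
      by (rule conj_by_left_eigen[OF CM CN \<rho> _ that]) (simp only: eig)
  qed (rule conj_by_meas_op_outside)
qed

section \<open>The four loop laws\<close>

lemma meas_op_perp: "meas_op B e (perp M) 1 = meas_op B e M 0"
  by (simp add: meas_op_def perp_def)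

lemma loop_fixpoint:
  assumes "wf_prog B G P" "binary_measurement B M"
  shows "prog_equiv B e (While M P) (Skip \<triangleleft> M \<triangleright> (P ;; While M P))"
  unfolding prog_equiv_def prog_sem_cond[OF assms(2)]
  using prog_sem_While_unfold[OF assms(2,1) partial_density_positive_trace_class]
  by (simp del: prog_sem.simps(7))

text \<open>The sides differ only on \<sigma>, the state after outcome 1 of \<open>N\<close>. The
  loop test leaves \<sigma> unchanged and its exit branch is 0, so unfolding the loop once on
  \<sigma> is the same as running \<open>P\<close> and then the loop.\<close>

lemma loop_unfolding:
  assumes P: "wf_prog B G P" and M: "binary_measurement B M" and N: "binary_measurement B N"
    and MN: "meas_propto B e M N"
  shows "prog_equiv B e (Skip \<triangleleft> N \<triangleright> While M P) (Skip \<triangleleft> N \<triangleright> (P ;; While M P))"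
  unfolding prog_equiv_def
proof
  fix \<rho> assume "\<rho> \<in> partial_density (configs B e)"
  then have \<rho>: "positive_trace_class (configs B e) \<rho>"
    by (rule partial_density_positive_trace_class)
  define \<sigma> where "\<sigma> = conj_by (configs B e) (meas_op B e N 1) \<rho>"
  have \<sigma>: "positive_trace_class (configs B e) \<sigma>"
    unfolding \<sigma>_def by (rule kraus_positive_trace_class(1)[OF contraction_binary_measurement[OF N] \<rho>]) simp
  obtain \<alpha> where "cmod \<alpha> = 1"
    "mat_mult (configs B e) (meas_op B e M 1) (meas_op B e N 1) = (\<lambda>c c'. \<alpha> * meas_op B e N 1 c c')"
    using MN by (auto simp: meas_propto_def)
  then have fixed: "conj_by (configs B e) (meas_op B e M 1) \<sigma> = \<sigma>"
    unfolding \<sigma>_def by (intro conj_by_meas_op_conj_by[OF M _ N _ \<rho>]) auto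
  have "conj_by (configs B e) (meas_op B e M 0) \<sigma> = (\<lambda>_ _. 0)"
    by (rule conj_by_meas_op_eq_0[OF M \<sigma> _ _ _ fixed]) auto
  then have "prog_sem B e (While M P) \<sigma> = prog_sem B e (While M P) (prog_sem B e P \<sigma>)"
    using prog_sem_While_unfold[OF M P \<sigma>] fixed by (simp del: prog_sem.simps(7))
  then show "prog_sem B e (Skip \<triangleleft> N \<triangleright> While M P) \<rho> = prog_sem B e (Skip \<triangleleft> N \<triangleright> (P ;; While M P)) \<rho>"
    unfolding prog_sem_cond[OF N] \<sigma>_def[symmetric] by (simp del: prog_sem.simps(7))
qed

text \<open>The state after outcome 1 of \<open>N\<close> leaves the loop unchanged at the first
  test, and the remaining rounds start from the zero matrix.\<close>

lemma loop_elimination: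
  assumes P: "wf_prog B G P" and M: "binary_measurement B M" and N: "binary_measurement B N"
    and MN: "meas_propto B e (perp M) N"
  shows "prog_equiv B e (Skip \<triangleleft> N \<triangleright> While M P) (just_measure N)"
  unfolding prog_equiv_def
proof
  fix \<rho> assume "\<rho> \<in> partial_density (configs B e)"
  then have \<rho>: "positive_trace_class (configs B e) \<rho>"
    by (rule partial_density_positive_trace_class)
  define \<sigma> where "\<sigma> = conj_by (configs B e) (meas_op B e N 1) \<rho>"
  have \<sigma>: "positive_trace_class (configs B e) \<sigma>"
    unfolding \<sigma>_def by (rule kraus_positive_trace_class(1)[OF contraction_binary_measurement[OF N] \<rho>]) simp
  obtain \<alpha> where "cmod \<alpha> = 1"
    "mat_mult (configs B e) (meas_op B e M 0) (meas_op B e N 1) = (\<lambda>c c'. \<alpha> * meas_op B e N 1 c c')"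
    using MN by (auto simp: meas_propto_def meas_op_perp[unfolded One_nat_def])
  then have fixed: "conj_by (configs B e) (meas_op B e M 0) \<sigma> = \<sigma>"
    unfolding \<sigma>_def by (intro conj_by_meas_op_conj_by[OF M _ N _ \<rho>]) auto
  have "conj_by (configs B e) (meas_op B e M 1) \<sigma> = (\<lambda>_ _. 0)"
    by (rule conj_by_meas_op_eq_0[OF M \<sigma> _ _ _ fixed]) auto
  then have "prog_sem B e (While M P) \<sigma> = \<sigma>"
    using prog_sem_While_unfold[OF M P \<sigma>] fixed by (simp add: prog_sem_zero del: prog_sem.simps(7))
  then show "prog_sem B e (Skip \<triangleleft> N \<triangleright> While M P) \<rho> = prog_sem B e (just_measure N) \<rho>"
    unfolding just_measure_def prog_sem_cond[OF N] \<sigma>_def[symmetric] by (simp del: prog_sem.simps(7))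
qed

text \<open>Every state that leaves the loop has the form
  \<open>M\<^sub>0 r\<^sub>n M\<^sub>0\<^sup>\<dagger>\<close> and is multiplied by the same phase
  \<alpha> under \<open>N\<^sub>1\<close>. A common eigenvalue passes to the sum \<open>W\<close>,
  so outcome 1 of \<open>N\<close> fixes \<open>W\<close>, outcome 0 sends it to 0, and measuring
  \<open>N\<close> acts as the identity on \<open>W\<close>.\<close>

lemma loop_postcondition:
  assumes P: "wf_prog B G P" and M: "binary_measurement B M" and N: "binary_measurement B N"
    and NM: "meas_gg B e N M"
  shows "prog_equiv B e (While M P) (While M P ;; just_measure N)"
  unfolding prog_equiv_def
proof
  fix \<rho> assume "\<rho> \<in> partial_density (configs B e)"
  then have \<rho>: "positive_trace_class (configs B e) \<rho>"
    by (rule partial_density_positive_trace_class)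
  let ?X = "configs B e" and ?E = "\<lambda>m. conj_by (configs B e) (meas_op B e M m)"
  define r where "r n = ((prog_sem B e P \<circ> ?E 1) ^^ n) \<rho>" for n
  define W where "W = prog_sem B e (While M P) \<rho>"
  have W_eq: "W = (\<lambda>c c'. \<Sum>\<^sub>\<infinity>n\<in>UNIV. ?E 0 (r n) c c')"
    unfolding W_def r_def by (rule prog_sem_While)
  note L = loop_positive_trace_class[OF contraction_binary_measurement[OF M] \<rho>
      prog_sem_positive_trace_class[OF P], folded r_def]
  have W: "positive_trace_class ?X W"
    unfolding W_eq by (rule infsum_positive_trace_class(2)[OF L(2,3)])
  obtain \<alpha> where \<alpha>: "cmod \<alpha> = 1" and
    eig: "mat_mult ?X (meas_op B e N 1) (meas_op B e M 0) = (\<lambda>c c'. \<alpha> * meas_op B e M 0 c c')"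
    using NM by (auto simp: meas_gg_def meas_propto_def meas_op_perp[unfolded One_nat_def])
  have CM: "contraction ?X ?X (meas_op B e M 0)" and CN: "contraction ?X ?X (meas_op B e N 1)"
    using contraction_stack_member[OF contraction_binary_measurement[OF M], of 0]
      contraction_stack_member[OF contraction_binary_measurement[OF N], of 1] by auto
  have fixed: "conj_by ?X (meas_op B e N 1) W = W"
  proof (rule conj_by_meas_op_fixed[OF W \<alpha>])
    fix x y assume xy: "x \<in> ?X" "y \<in> ?X"
    show "(\<Sum>\<^sub>\<infinity>u\<in>?X. meas_op B e N 1 x u * W u y) = \<alpha> * W x y"
      unfolding W_eq
    proof (rule infsum_left_eigen[OF CN L(2,3) _ xy])
      show "(\<Sum>\<^sub>\<infinity>u\<in>?X. meas_op B e N 1 x u * ?E 0 (r n) u y) = \<alpha> * ?E 0 (r n) x y" for n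
        by (rule conj_by_left_eigen[OF CN CM L(1) _ xy]) (simp_all only: eig)
    qed
  qed (simp add: W_eq conj_by_meas_op_outside)
  have "conj_by ?X (meas_op B e N 0) W = (\<lambda>_ _. 0)"
    by (rule conj_by_meas_op_eq_0[OF N W _ _ _ fixed]) auto
  then have "prog_sem B e (just_measure N) W = W"
    unfolding just_measure_def prog_sem_cond[OF N] using fixed by simp
  then show "prog_sem B e (While M P) \<rho> = prog_sem B e (While M P ;; just_measure N) \<rho>"
    by (simp add: W_def del: prog_sem.simps(7))
qed

theorem proposition6p3:
  fixes B :: "'q \<Rightarrow> 'b set" and e :: "'q \<Rightarrow> 'b" and G :: "'b list mat set"
    and P :: "('q, 'b) prog" and M N :: "('q, 'b) meas"
  assumes "\<And>q. e q \<in> B q"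
    and "wf_prog B G P"
    and "binary_measurement B M" and "binary_measurement B N"
  shows "prog_equiv B e (While M P) (Skip \<triangleleft> M \<triangleright> (P ;; While M P)) \<and>
    (meas_propto B e M N \<longrightarrow>
       prog_equiv B e (Skip \<triangleleft> N \<triangleright> While M P) (Skip \<triangleleft> N \<triangleright> (P ;; While M P))) \<and>
    (meas_propto B e (perp M) N \<longrightarrow>
       prog_equiv B e (Skip \<triangleleft> N \<triangleright> While M P) (just_measure N)) \<and>
    (meas_gg B e N M \<longrightarrow>
       prog_equiv B e (While M P) (While M P ;; just_measure N))"
  using loop_fixpoint[OF assms(2,3)] loop_unfolding[OF assms(2-4)] loop_elimination[OF assms(2-4)]
    loop_postcondition[OF assms(2-4)]
  by blast

end
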